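(* Consider the Curie-Weiss model on $\Omega=\{-1,1\}^N$ with inverse temperature $\beta>0$ and external field $h$. For any $h$ and $\beta$, and for any $k\ge2$, the random scan (superscript rs) and systemic scan (superscript ss) Glauber dynamics satisfy $$\kappa_1^{\mathrm{rs}}\ge\left(1-\beta\frac{N-1}{N}\right)\frac1N,\qquad \kappa_1^{\mathrm{ss}}\ge2-\mathrm{e}^{\beta},$$ $$\kappa_k^{\mathrm{ss}}\ge1-\beta\,\mathrm{e}^{\beta}\left(\beta\frac{N-1}{N}\right)^{k-1},\qquad \gamma_{\mathrm{ps}}^{\mathrm{ss}}\ge\frac{1-\beta\cdot(N-1)/N}{4}.$$ Finally, for $\beta=1$ and $h=0$ (the critical phase), there exists a universal constant $C>0$ such that for any $N$ and any $k\ge CN^{3/2}\log(N)$ one has $\kappa_k^{\mathrm{rs}}\ge1/2$, and $(\kappa_\Sigma^c)^{\mathrm{rs}}\le2CN^{3/2}\log(N)$.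
   Context: The Curie-Weiss model: for $\omega\in\Omega=\{-1,1\}^N$ let $H(\omega)=\frac{\beta}{N}\sum_{1\le i<j\le N}\omega_i\omega_j+h\sum_{i\le N}\omega_i$ and $\pi(\omega)=\exp(H(\omega))/Z$, $Z$ the normalising constant. $\Omega$ carries the Hamming distance $d(x,y)=\sum_{i=1}^N\mathbf{1}[x_i\ne y_i]$. Random scan Glauber dynamics: in each step pick $I$ uniformly from $\{1,\ldots,N\}$ and resample coordinate $I$ from its conditional distribution under $\pi$ given the other coordinates. Systemic scan Glauber dynamics: in each step go through coordinates $1,2,\ldots,N$ in this order, resampling each in turn from its conditional distribution under $\pi$ given the current values of the others. Both have stationary distribution $\pi$. For a Markov kernel $P$ on $\Omega$ with $k$-step laws $P^k_x$ ($P^0_x=\delta_x$): $W_1(\mu_1,\mu_2)=\inf\mathbb{E}(d(X,Y))$ over couplings $(X,Y)$ of $\mu_1,\mu_2$; $\kappa_k(x,y)=1-W_1(P^k_x,P^k_y)/d(x,y)$ for $x\ne y$, $\kappa_k(x,x)=1$, $\kappa_k=\inf_{x,y}\kappa_k(x,y)$ for integers $k\ge 0$; $\kappa_\Sigma^c=\sum_{k=0}^\infty(1-\kappa_k)$. Pseudo spectral gap: with $P^*(x,y)=\pi(y)P(y,x)/\pi(x)$ the time reversal, $\gamma_{\mathrm{ps}}=\max_{k\ge1}\gamma((P^* )^kP^k)/k$, where for a reversible kernel $Q$, $\gamma(Q)=1-\sup\{\lambda:\lambda\text{ a nonzero eigenvalue of }Q,\ \lambda\ne1\}$ if the eigenvalue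 $1$ has multiplicity $1$, and $\gamma(Q)=0$ otherwise.
   Formalization: The bound on κ_k^ss for k≥2 is stated only when β(N−1)/N ≤ 1 (for each β>1 it fails for some N and k, e.g. β=3, k=2, h=0, N large); the critical-phase claims are stated for N≥2 (for N=1, log N=0 and κ_0=0<1/2). *)

theory Defs
  imports "HOL-Probability.Probability" "HOL-Library.Function_Algebras"
begin

section \<open>Markov kernels, Wasserstein distance, coarse Ricci curvature\<close>

text \<open>A Markov kernel on a finite set \<open>S\<close> is a function \<open>P :: 'a \<Rightarrow> 'a pmf\<close>; only its values at
  points of \<open>S\<close> matter.\<close>

definition kernel_power :: "('a \<Rightarrow> 'a pmf) \<Rightarrow> nat \<Rightarrow> 'a \<Rightarrow> 'a pmf" where
  "kernel_power P k x = ((\<lambda>\<mu>. bind_pmf \<mu> P) ^^ k) (return_pmf x)"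

definition wasserstein1 :: "('a \<Rightarrow> 'a \<Rightarrow> real) \<Rightarrow> 'a pmf \<Rightarrow> 'a pmf \<Rightarrow> real" where
  "wasserstein1 d \<mu>1 \<mu>2 =
     (INF \<rho>\<in>{\<rho>. map_pmf fst \<rho> = \<mu>1 \<and> map_pmf snd \<rho> = \<mu>2}.
        measure_pmf.expectation \<rho> (\<lambda>(x, y). d x y))"

definition ricci_pt ::
  "('a \<Rightarrow> 'a \<Rightarrow> real) \<Rightarrow> ('a \<Rightarrow> 'a pmf) \<Rightarrow> nat \<Rightarrow> 'a \<Rightarrow> 'a \<Rightarrow> real" where
  "ricci_pt d P k x y =
     (if x = y then 1
      else 1 - wasserstein1 d (kernel_power P k x) (kernel_power P k y) / d x y)"

definition ricci :: "'a set \<Rightarrow> ('a \<Rightarrow> 'a \<Rightarrow> real) \<Rightarrow> ('a \<Rightarrow> 'a pmf) \<Rightarrow> nat \<Rightarrow> real" where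
  "ricci S d P k = (INF (x, y)\<in>S \<times> S. ricci_pt d P k x y)"

text \<open>The series \<open>\<Sum>k. 1 - \<kappa>\<^sub>k\<close> has nonnegative terms and may diverge, so it is taken in \<open>ennreal\<close>;
  an upper bound by a finite number then includes convergence.\<close>

definition ricci_sum_compl :: "'a set \<Rightarrow> ('a \<Rightarrow> 'a \<Rightarrow> real) \<Rightarrow> ('a \<Rightarrow> 'a pmf) \<Rightarrow> ennreal" where
  "ricci_sum_compl S d P = (\<Sum>k. ennreal (1 - ricci S d P k))"


section \<open>Pseudo spectral gap\<close>

text \<open>The normalisation condition behind \<open>embed_pmf\<close> holds when \<open>\<pi>\<close> is stationary and \<open>\<pi>(x) > 0\<close>,
  see \<open>pmf_time_reversal\<close>.\<close>

definition time_reversal :: "'a pmf \<Rightarrow> ('a \<Rightarrow> 'a pmf) \<Rightarrow> 'a \<Rightarrow> 'a pmf" where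
  "time_reversal \<pi> P x = embed_pmf (\<lambda>y. pmf \<pi> y * pmf (P y) x / pmf \<pi> x)"

lemma pmf_time_reversal:
  assumes stat: "bind_pmf \<pi> P = \<pi>" and x: "x \<in> set_pmf \<pi>"
  shows "pmf (time_reversal \<pi> P x) y = pmf \<pi> y * pmf (P y) x / pmf \<pi> x"
  unfolding time_reversal_def
proof (rule pmf_embed_pmf)
  have pos: "pmf \<pi> x > 0" using x by (simp add: pmf_positive)
  have "(\<integral>\<^sup>+y. ennreal (pmf \<pi> y * pmf (P y) x / pmf \<pi> x) \<partial>count_space UNIV)
      = (\<integral>\<^sup>+y. (ennreal (pmf \<pi> y) * ennreal (pmf (P y) x)) / ennreal (pmf \<pi> x) \<partial>count_space UNIV)"
    using pos by (intro nn_integral_cong) (simp add: ennreal_mult flip: divide_ennreal)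
  also have "\<dots> = (\<integral>\<^sup>+y. ennreal (pmf \<pi> y) * ennreal (pmf (P y) x) \<partial>count_space UNIV)
      / ennreal (pmf \<pi> x)"
    by (rule nn_integral_divide) simp
  also have "(\<integral>\<^sup>+y. ennreal (pmf \<pi> y) * ennreal (pmf (P y) x) \<partial>count_space UNIV)
      = (\<integral>\<^sup>+y. ennreal (pmf (P y) x) \<partial>measure_pmf \<pi>)"
    by (simp add: nn_integral_measure_pmf)
  also have "\<dots> = ennreal (pmf \<pi> x)"
    using stat by (metis ennreal_pmf_bind)
  finally show "(\<integral>\<^sup>+y. ennreal (pmf \<pi> y * pmf (P y) x / pmf \<pi> x) \<partial>count_space UNIV) = 1"
    using pos by (simp add: ennreal_divide_self)
qed simp

text \<open>Functions on \<open>S\<close> are represented by functions vanishing outside \<open>S\<close>. Only reversible kernels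
  are considered, so real eigenvalues suffice, and algebraic and geometric multiplicities agree.\<close>

definition eigenspace :: "'a set \<Rightarrow> ('a \<Rightarrow> 'a pmf) \<Rightarrow> real \<Rightarrow> ('a \<Rightarrow> real) set" where
  "eigenspace S Q l =
     {f. (\<forall>x. x \<notin> S \<longrightarrow> f x = 0) \<and> (\<forall>x\<in>S. measure_pmf.expectation (Q x) f = l * f x)}"

definition kernel_eigenvalue :: "'a set \<Rightarrow> ('a \<Rightarrow> 'a pmf) \<Rightarrow> real \<Rightarrow> bool" where
  "kernel_eigenvalue S Q l \<longleftrightarrow> (\<exists>f\<in>eigenspace S Q l. \<exists>x. f x \<noteq> 0)"

definition eigen_mult :: "'a set \<Rightarrow> ('a \<Rightarrow> 'a pmf) \<Rightarrow> real \<Rightarrow> nat" where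
  "eigen_mult S Q l = vector_space.dim (\<lambda>c f x. c * f x) (eigenspace S Q l)"

text \<open>If 1 is a simple eigenvalue and there is no other nonzero eigenvalue (perfect mixing in one
  step), the supremum over the empty set is read as 0, giving gap 1.\<close>

definition spectral_gap :: "'a set \<Rightarrow> ('a \<Rightarrow> 'a pmf) \<Rightarrow> real" where
  "spectral_gap S Q =
     (if eigen_mult S Q 1 = 1
      then 1 - (let E = {l. kernel_eigenvalue S Q l \<and> l \<noteq> 0 \<and> l \<noteq> 1}
                in if E = {} then 0 else Sup E)
      else 0)"

text \<open>The operator product of \<open>(P\<^sup>*)\<^sup>k\<close> and \<open>P\<^sup>k\<close> is the kernel that first makes \<open>k\<close> steps of
  \<open>P\<^sup>*\<close> and then \<open>k\<close> steps of \<open>P\<close>.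
  The supremum is a maximum: its terms lie between 0 and \<open>1 / k\<close>.\<close>

definition pseudo_spectral_gap :: "'a pmf \<Rightarrow> ('a \<Rightarrow> 'a pmf) \<Rightarrow> real" where
  "pseudo_spectral_gap \<pi> P =
     (SUP k\<in>{1..}. spectral_gap (set_pmf \<pi>)
        (\<lambda>x. bind_pmf (kernel_power (time_reversal \<pi> P) k x) (kernel_power P k)) / real k)"


section \<open>The Curie-Weiss model and its Glauber dynamics\<close>

definition configs :: "nat \<Rightarrow> (nat \<Rightarrow> real) set" where
  "configs N = PiE {1..N} (\<lambda>_. {-1, 1})"

definition hamming :: "nat \<Rightarrow> (nat \<Rightarrow> real) \<Rightarrow> (nat \<Rightarrow> real) \<Rightarrow> real" where
  "hamming N x y = real (card {i\<in>{1..N}. x i \<noteq> y i})"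

definition cw_energy :: "nat \<Rightarrow> real \<Rightarrow> real \<Rightarrow> (nat \<Rightarrow> real) \<Rightarrow> real" where
  "cw_energy N \<beta> h \<omega> =
     \<beta> / real N * (\<Sum>i=1..N. \<Sum>j\<in>{i<..N}. \<omega> i * \<omega> j) + h * (\<Sum>i=1..N. \<omega> i)"

definition cw_partition :: "nat \<Rightarrow> real \<Rightarrow> real \<Rightarrow> real" where
  "cw_partition N \<beta> h = (\<Sum>\<omega>\<in>configs N. exp (cw_energy N \<beta> h \<omega>))"

definition curie_weiss :: "nat \<Rightarrow> real \<Rightarrow> real \<Rightarrow> (nat \<Rightarrow> real) pmf" where
  "curie_weiss N \<beta> h = embed_pmf (\<lambda>\<omega>.
     if \<omega> \<in> configs N then exp (cw_energy N \<beta> h \<omega>) / cw_partition N \<beta> h else 0)"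

lemma finite_configs: "finite (configs N)"
  unfolding configs_def by (intro finite_PiE) auto

lemma configs_nonempty: "configs N \<noteq> {}"
  unfolding configs_def by (simp add: PiE_eq_empty_iff)

lemma cw_partition_pos: "cw_partition N \<beta> h > 0"
  unfolding cw_partition_def using finite_configs configs_nonempty by (intro sum_pos) auto

lemma pmf_curie_weiss:
  "pmf (curie_weiss N \<beta> h) \<omega> =
     (if \<omega> \<in> configs N then exp (cw_energy N \<beta> h \<omega>) / cw_partition N \<beta> h else 0)"
  unfolding curie_weiss_def
proof (rule pmf_embed_pmf)
  let ?f = "\<lambda>\<omega>. if \<omega> \<in> configs N then exp (cw_energy N \<beta> h \<omega>) / cw_partition N \<beta> h else 0"
  have Z: "cw_partition N \<beta> h > 0" by (rule cw_partition_pos)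
  show "0 \<le> ?f \<omega>" for \<omega> using Z by simp
  have "(\<integral>\<^sup>+\<omega>. ennreal (?f \<omega>) \<partial>count_space UNIV) = (\<Sum>\<omega>\<in>configs N. ennreal (?f \<omega>))"
    by (rule nn_integral_count_space'[OF finite_configs]) auto
  also have "\<dots> = ennreal (\<Sum>\<omega>\<in>configs N. ?f \<omega>)"
    using Z by (intro sum_ennreal) simp
  also have "(\<Sum>\<omega>\<in>configs N. ?f \<omega>) = 1"
    using Z by (simp add: cw_partition_def flip: sum_divide_distrib)
  finally show "(\<integral>\<^sup>+\<omega>. ennreal (?f \<omega>) \<partial>count_space UNIV) = 1" by simp
qed

lemma set_curie_weiss: "set_pmf (curie_weiss N \<beta> h) = configs N"
  using cw_partition_pos[of N \<beta> h] by (auto simp: set_pmf_eq pmf_curie_weiss)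

definition resample :: "nat \<Rightarrow> real \<Rightarrow> real \<Rightarrow> nat \<Rightarrow> (nat \<Rightarrow> real) \<Rightarrow> (nat \<Rightarrow> real) pmf" where
  "resample N \<beta> h i x = cond_pmf (curie_weiss N \<beta> h) {\<omega>. \<forall>j\<in>{1..N} - {i}. \<omega> j = x j}"

definition random_scan :: "nat \<Rightarrow> real \<Rightarrow> real \<Rightarrow> (nat \<Rightarrow> real) \<Rightarrow> (nat \<Rightarrow> real) pmf" where
  "random_scan N \<beta> h x = bind_pmf (pmf_of_set {1..N}) (\<lambda>i. resample N \<beta> h i x)"

definition systemic_scan :: "nat \<Rightarrow> real \<Rightarrow> real \<Rightarrow> (nat \<Rightarrow> real) \<Rightarrow> (nat \<Rightarrow> real) pmf" where
  "systemic_scan N \<beta> h x =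
     fold (\<lambda>i \<mu>. bind_pmf \<mu> (resample N \<beta> h i)) [1..<Suc N] (return_pmf x)"

abbreviation kappa_rs :: "nat \<Rightarrow> real \<Rightarrow> real \<Rightarrow> nat \<Rightarrow> real" where
  "kappa_rs N \<beta> h \<equiv> ricci (configs N) (hamming N) (random_scan N \<beta> h)"

abbreviation kappa_ss :: "nat \<Rightarrow> real \<Rightarrow> real \<Rightarrow> nat \<Rightarrow> real" where
  "kappa_ss N \<beta> h \<equiv> ricci (configs N) (hamming N) (systemic_scan N \<beta> h)"

abbreviation kappa_sum_rs :: "nat \<Rightarrow> real \<Rightarrow> real \<Rightarrow> ennreal" where
  "kappa_sum_rs N \<beta> h \<equiv> ricci_sum_compl (configs N) (hamming N) (random_scan N \<beta> h)"

abbreviation gamma_ps_ss :: "nat \<Rightarrow> real \<Rightarrow> real \<Rightarrow> real" where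
  "gamma_ps_ss N \<beta> h \<equiv> pseudo_spectral_gap (curie_weiss N \<beta> h) (systemic_scan N \<beta> h)"

end

theory Submission
  imports Defs
begin

text \<open>
  All curvature bounds come from the coupling that thresholds both copies of the resampled coordinate
  against one uniform variable. Writing \<open>e\<^sub>j = \<bbbE> |X\<^sub>j - Y\<^sub>j| / 2\<close>, resampling site \<open>i\<close> replaces \<open>e\<^sub>i\<close> by at
  most \<open>\<beta> / N\<close> times the sum of the other \<open>e\<^sub>j\<close>, since \<open>tanh\<close> is 1-Lipschitz. One sweep
  multiplies the sum of the \<open>e\<^sub>j\<close> by at most \<open>(1 + \<beta> / N)\<^sup>N - 1\<close>, and every sweep, in whatever order,
  multiplies their maximum by \<open>\<theta> = \<beta> (N - 1) / N\<close> if \<open>\<theta> \<le> 1\<close>. The time reversal of the systemic scan \<open>P\<close>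
  sweeps in the opposite order, so for \<open>\<theta> < 1\<close> an eigenfunction of \<open>P\<^sup>*P\<close> with eigenvalue \<open>> \<theta>\<close> is constant.

  At \<open>\<beta> = 1\<close>, \<open>h = 0\<close> the coupling is monotone, so the expected distance after \<open>k\<close> steps is at most
  the expected magnetization \<open>g\<^sub>k(N)\<close> of the chain started from all spins up. The function \<open>g\<^sub>k\<close> is odd and
  arises by iterating the generator of the magnetization walk, for which \<open>sqrt s\<close> is a Lyapunov function:
  at \<open>s > 0\<close> the drift contributes a relative decrease of order \<open>s\<^sup>2 / N\<^sup>3\<close> and the diffusion one of order
  \<open>1 / s\<^sup>2\<close>, together at least of order \<open>N\<close> to the power \<open>-3/2\<close>.
\<close>

section \<open>Kernels, couplings and single-site updates\<close>

lemma expectation_bind_finite: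
  fixes f :: "'b \<Rightarrow> real"
  assumes "finite (set_pmf p)" and "\<And>x. x \<in> set_pmf p \<Longrightarrow> finite (set_pmf (K x))"
  shows "measure_pmf.expectation (bind_pmf p K) f =
    measure_pmf.expectation p (\<lambda>x. measure_pmf.expectation (K x) f)"
  by (subst pmf_expectation_bind[where A = "set_pmf p"])
    (use assms in \<open>auto simp: integral_measure_pmf_real[where A = "set_pmf p"] mult.commute\<close>)

lemma expectation_mono_finite:
  fixes f g :: "'a \<Rightarrow> real"
  assumes "finite (set_pmf p)" and "\<And>x. x \<in> set_pmf p \<Longrightarrow> f x \<le> g x"
  shows "measure_pmf.expectation p f \<le> measure_pmf.expectation p g"
  using assms by (intro integral_mono_AE integrable_measure_pmf_finite) (auto simp: AE_measure_pmf_iff)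

lemma expectation_sum_finite:
  fixes f :: "'b \<Rightarrow> 'a \<Rightarrow> real"
  assumes "finite (set_pmf p)"
  shows "measure_pmf.expectation p (\<lambda>x. \<Sum>j\<in>J. f j x) = (\<Sum>j\<in>J. measure_pmf.expectation p (f j))"
  by (rule Bochner_Integration.integral_sum) (rule integrable_measure_pmf_finite[OF assms])

lemma expectation_cong_pmf:
  assumes "\<And>x. x \<in> set_pmf p \<Longrightarrow> f x = g x"
  shows "measure_pmf.expectation p f = measure_pmf.expectation p g"
  using assms by (intro integral_cong_AE) (auto simp: AE_measure_pmf_iff)

lemma abs_expectation_le:
  fixes f :: "'a \<Rightarrow> real"
  assumes "\<And>x. \<bar>f x\<bar> \<le> B"
  shows "\<bar>measure_pmf.expectation p f\<bar> \<le> B"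
proof -
  have int: "integrable p f"
    using assms by (intro measure_pmf.integrable_const_bound[where B = B]) auto
  have "measure_pmf.expectation p f \<le> measure_pmf.expectation p (\<lambda>_. B)"
    using assms by (intro integral_mono int) (auto intro: abs_le_D1)
  moreover have "measure_pmf.expectation p (\<lambda>_. - B) \<le> measure_pmf.expectation p f"
    using assms by (intro integral_mono int) (simp_all add: abs_le_iff minus_le_iff)
  ultimately show ?thesis by simp
qed

section \<open>Kernel powers, couplings and scans\<close>

lemma kernel_power_0 [simp]: "kernel_power P 0 x = return_pmf x"
  by (simp add: kernel_power_def)

lemma kernel_power_Suc [simp]: "kernel_power P (Suc k) x = bind_pmf (kernel_power P k x) P"
  by (simp add: kernel_power_def)

lemma kernel_power_1: "kernel_power P 1 x = P x"
  by (simp add: bind_return_pmf)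

text \<open>\<open>resample\<close> and \<open>update\<close> are compared only on configurations.
  Since the chain never leaves \<open>S\<close>, agreement there identifies all powers.\<close>

lemma kernel_power_cong:
  assumes "\<And>z. z \<in> S \<Longrightarrow> P z = Q z" and "\<And>z. z \<in> S \<Longrightarrow> set_pmf (Q z) \<subseteq> S" and "x \<in> S"
  shows "kernel_power P k x = kernel_power Q k x \<and> set_pmf (kernel_power Q k x) \<subseteq> S"
proof (induction k)
  case (Suc k)
  then show ?case using assms by (auto intro!: bind_pmf_cong)
qed (use assms in auto)

text \<open>Finite support at every point makes every real function integrable, so expectations can
  be split and reordered without side conditions on the function.\<close>

definition finite_kernel :: "('a \<Rightarrow> 'b pmf) \<Rightarrow> bool" where
  "finite_kernel K \<longleftrightarrow> (\<forall>x. finite (set_pmf (K x)))"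

lemma finite_kernelD: "finite_kernel K \<Longrightarrow> finite (set_pmf (K x))"
  by (simp add: finite_kernel_def)

lemma finite_kernel_power: "finite_kernel K \<Longrightarrow> finite (set_pmf (kernel_power K k x))"
  by (induction k) (auto simp: finite_kernel_def)

text \<open>A Markovian coupling: each marginal of \<open>Q z\<close> depends only on its own
  coordinate of \<open>z\<close>. This is why powers and scans of couplings are couplings
  again.\<close>

definition couples :: "('a \<times> 'a \<Rightarrow> ('a \<times> 'a) pmf) \<Rightarrow> ('a \<Rightarrow> 'a pmf) \<Rightarrow> bool" where
  "couples Q K \<longleftrightarrow> (\<forall>z. map_pmf fst (Q z) = K (fst z) \<and> map_pmf snd (Q z) = K (snd z))"

lemma map_pmf_bind_couples:
  assumes "couples Q K"
  shows "map_pmf fst (bind_pmf \<rho> Q) = bind_pmf (map_pmf fst \<rho>) K"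
    and "map_pmf snd (bind_pmf \<rho> Q) = bind_pmf (map_pmf snd \<rho>) K"
  using assms by (auto simp: couples_def map_bind_pmf bind_map_pmf simp del: split_paired_All)

lemma couples_kernel_power:
  assumes "couples Q K"
  shows "couples (kernel_power Q k) (kernel_power K k)"
proof -
  have "map_pmf fst (kernel_power Q k z) = kernel_power K k (fst z) \<and>
    map_pmf snd (kernel_power Q k z) = kernel_power K k (snd z)" for z
    by (induction k) (simp_all add: map_pmf_bind_couples[OF assms])
  then show ?thesis by (simp add: couples_def)
qed

text \<open>The list of sites is arbitrary because the reversed order and the there-and-back order
  occur as well; the start is a law rather than a point so that scans concatenate.\<close>

definition scan :: "('i \<Rightarrow> 'a \<Rightarrow> 'a pmf) \<Rightarrow> 'i list \<Rightarrow> 'a pmf \<Rightarrow> 'a pmf" where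
  "scan U js \<mu> = fold (\<lambda>i \<nu>. bind_pmf \<nu> (U i)) js \<mu>"

lemma scan_Nil [simp]: "scan U [] \<mu> = \<mu>"
  by (simp add: scan_def)

lemma scan_snoc [simp]: "scan U (js @ [i]) \<mu> = bind_pmf (scan U js \<mu>) (U i)"
  by (simp add: scan_def)

lemma scan_append: "scan U (js @ ks) \<mu> = scan U ks (scan U js \<mu>)"
  by (simp add: scan_def)

lemma scan_bind: "bind_pmf \<mu> (\<lambda>x. scan U js (return_pmf x)) = scan U js \<mu>"
  by (induction js rule: rev_induct) (simp_all add: bind_return_pmf' bind_assoc_pmf[symmetric])

lemma finite_scan:
  assumes "\<And>i. finite_kernel (U i)" "finite (set_pmf \<mu>)"
  shows "finite (set_pmf (scan U js \<mu>))"
  by (induction js rule: rev_induct) (use assms in \<open>auto simp: finite_kernel_def\<close>)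

lemma couples_scan:
  assumes "\<And>i. couples (Q i) (U i)"
  shows "couples (\<lambda>z. scan Q js (return_pmf z)) (\<lambda>x. scan U js (return_pmf x))"
proof -
  have "map_pmf fst (scan Q js (return_pmf z)) = scan U js (return_pmf (fst z)) \<and>
    map_pmf snd (scan Q js (return_pmf z)) = scan U js (return_pmf (snd z))" for z
    by (induction js rule: rev_induct) (simp_all add: map_pmf_bind_couples[OF assms])
  then show ?thesis by (simp add: couples_def)
qed

lemma scan_cong:
  assumes "\<And>i z. i \<in> set js \<Longrightarrow> z \<in> S \<Longrightarrow> U i z = V i z"
    and "\<And>i z. i \<in> set js \<Longrightarrow> z \<in> S \<Longrightarrow> set_pmf (V i z) \<subseteq> S" and "set_pmf \<mu> \<subseteq> S"
  shows "scan U js \<mu> = scan V js \<mu> \<and> set_pmf (scan V js \<mu>) \<subseteq> S"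
  using assms(1,2)
proof (induction js rule: rev_induct)
  case (snoc i js)
  then have "scan U js \<mu> = scan V js \<mu>" "set_pmf (scan V js \<mu>) \<subseteq> S" by auto
  then show ?case using snoc.prems by (simp add: UN_subset_iff subset_iff cong: bind_pmf_cong) blast
qed (use assms(3) in auto)

lemma wasserstein1_le_coupling:
  fixes d :: "'a \<Rightarrow> 'a \<Rightarrow> real"
  assumes d: "\<And>x y. d x y \<ge> 0" and Q: "couples Q K"
  shows "wasserstein1 d (K x) (K y) \<le> measure_pmf.expectation (Q (x, y)) (\<lambda>(x, y). d x y)"
  unfolding wasserstein1_def
proof (rule cINF_lower)
  \<comment> \<open>A real infimum is known to lie below a member only if the set is bounded below;
    nonnegativity of \<open>d\<close> supplies the bound 0.\<close>
  show "bdd_below ((\<lambda>\<rho>. measure_pmf.expectation \<rho> (\<lambda>(x, y). d x y)) `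
      {\<rho>. map_pmf fst \<rho> = K x \<and> map_pmf snd \<rho> = K y})"
    using d by (intro bdd_belowI[where m = 0]) (auto intro!: integral_nonneg_AE)
  show "Q (x, y) \<in> {\<rho>. map_pmf fst \<rho> = K x \<and> map_pmf snd \<rho> = K y}"
    using Q by (simp add: couples_def)
qed

section \<open>Coupling two biased spins\<close>

definition spin :: "bool \<Rightarrow> real" where
  "spin b = (if b then 1 else - 1)"

lemma spin_simps [simp]: "spin True = 1" "spin False = - 1"
  by (simp_all add: spin_def)

lemma finite_set_pmf_bool: "finite (set_pmf (p :: bool pmf))"
  by (rule finite_subset[OF subset_UNIV]) simp

text \<open>Both coordinates are thresholded against a common uniform variable.\<close>

definition bernoulli_pair :: "real \<Rightarrow> real \<Rightarrow> (bool \<times> bool) pmf" where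
  "bernoulli_pair p q = bind_pmf (bernoulli_pmf (max p q)) (\<lambda>a.
     map_pmf (\<lambda>b. if p \<ge> q then (a, a \<and> b) else (a \<and> b, a)) (bernoulli_pmf (min p q / max p q)))"

text \<open>One of the two discordant outcomes has weight 0. Hence the spins disagree with
  probability |p - q|, and always in favour of the larger parameter: the first fact gives the
  contraction estimates, the second the monotone coupling.\<close>

lemma expectation_bernoulli_pair:
  assumes "0 < p" "p < 1" "0 < q" "q < 1"
  shows "measure_pmf.expectation (bernoulli_pair p q) F =
    F (True, True) * min p q + F (True, False) * (p - min p q) +
    F (False, True) * (q - min p q) + F (False, False) * (1 - max p q)"
proof -
  have "measure_pmf.expectation (bernoulli_pair p q) F =
    measure_pmf.expectation (bernoulli_pmf (max p q)) (\<lambda>a. measure_pmf.expectation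
      (bernoulli_pmf (min p q / max p q)) (\<lambda>b. F (if p \<ge> q then (a, a \<and> b) else (a \<and> b, a))))"
    unfolding bernoulli_pair_def
    by (subst expectation_bind_finite) (auto simp: finite_set_pmf_bool)
  also have "\<dots> = max p q * (F (True, True) * (min p q / max p q) +
      F (if p \<ge> q then (True, False) else (False, True)) * (1 - min p q / max p q)) +
      (1 - max p q) * F (False, False)"
    using assms by (auto simp: min_def max_def algebra_simps)
  also have "\<dots> = F (True, True) * min p q +
      F (if p \<ge> q then (True, False) else (False, True)) * (max p q - min p q) +
      F (False, False) * (1 - max p q)"
  proof -
    have "max p q * (a * (min p q / max p q) + b * (1 - min p q / max p q)) =
      a * min p q + b * (max p q - min p q)" for a b
      using assms by (simp add: field_simps less_max_iff_disj)
    then show ?thesis by simp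
  qed
  finally show ?thesis by (simp add: min_def max_def)
qed

text \<open>Reduces the identification of the two marginals to evaluating
  \<open>expectation_bernoulli_pair\<close> at an indicator.\<close>

lemma bernoulli_eqI:
  assumes "measure_pmf.expectation \<mu> (\<lambda>b. if b then 1 else 0) = p" "0 \<le> p" "p \<le> 1"
  shows "\<mu> = bernoulli_pmf p"
proof (rule pmf_eqI)
  have T: "pmf \<mu> True = p"
    using assms by (subst (asm) integral_measure_pmf_real[where A = UNIV]) (auto simp: UNIV_bool)
  have "measure_pmf.expectation \<mu> (\<lambda>b. 1::real) = 1" by simp
  then have "pmf \<mu> True + pmf \<mu> False = 1"
    by (subst (asm) integral_measure_pmf_real[where A = UNIV]) (auto simp: UNIV_bool simp del: lebesgue_integral_const)
  then show "pmf \<mu> b = pmf (bernoulli_pmf p) b" for b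
    using T assms by (cases b) auto
qed

lemma marginals_bernoulli_pair:
  assumes "0 < p" "p < 1" "0 < q" "q < 1"
  shows "map_pmf fst (bernoulli_pair p q) = bernoulli_pmf p"
    and "map_pmf snd (bernoulli_pair p q) = bernoulli_pmf q"
  using assms by (auto intro!: bernoulli_eqI simp: expectation_bernoulli_pair min_def max_def)

lemma sum_fun_upd:
  fixes x :: "'a \<Rightarrow> 'b :: comm_monoid_add"
  assumes "finite A" "i \<in> A"
  shows "(\<Sum>j\<in>A. (x(i := s)) j) = s + (\<Sum>j\<in>A - {i}. x j)"
  using assms by (subst sum.remove[of _ i]) (auto intro!: sum.cong)

lemma tanh_exp_ratio:
  fixes a b :: real
  shows "exp a / (exp a + exp b) = (1 + tanh ((a - b) / 2)) / 2"
proof -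
  have e: "exp (b - a) = exp b / exp a" by (rule exp_diff)
  have *: "- 2 * ((a - b) / 2) = b - a" by (simp add: field_simps)
  have "tanh ((a - b) / 2) = (1 - exp (b - a)) / (1 + exp (b - a))"
    unfolding tanh_real_altdef * ..
  also have "\<dots> = (exp a - exp b) / (exp a + exp b)"
    unfolding e by (simp add: divide_simps add_pos_pos less_imp_neq[symmetric])
  finally have t: "tanh ((a - b) / 2) = (exp a - exp b) / (exp a + exp b)" .
  have "exp a + exp b > 0" by (simp add: add_pos_pos)
  then show ?thesis unfolding t by (simp add: field_simps)
qed

section \<open>Single-site updates in closed form\<close>

locale glauber =
  fixes N :: nat and \<beta> h :: real
  assumes N_pos: "N \<ge> 1" and beta_pos: "\<beta> > 0"
begin

text \<open>The conditional probability of a plus spin at \<open>i\<close> given the other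
  coordinates. The argument of \<open>tanh\<close> is half the energy difference of the two
  completions.\<close>

definition plus_prob :: "nat \<Rightarrow> (nat \<Rightarrow> real) \<Rightarrow> real" where
  "plus_prob i x = (1 + tanh (\<beta> / real N * (\<Sum>j\<in>{1..N} - {i}. x j) + h)) / 2"

definition update :: "nat \<Rightarrow> (nat \<Rightarrow> real) \<Rightarrow> (nat \<Rightarrow> real) pmf" where
  "update i x = map_pmf (\<lambda>b. x(i := spin b)) (bernoulli_pmf (plus_prob i x))"

definition update_pair ::
  "nat \<Rightarrow> (nat \<Rightarrow> real) \<times> (nat \<Rightarrow> real) \<Rightarrow> ((nat \<Rightarrow> real) \<times> (nat \<Rightarrow> real)) pmf" where
  "update_pair i z = map_pmf (\<lambda>(a, b). ((fst z)(i := spin a), (snd z)(i := spin b)))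
     (bernoulli_pair (plus_prob i (fst z)) (plus_prob i (snd z)))"

lemma plus_prob_bounds: "0 < plus_prob i x" "plus_prob i x < 1"
  unfolding plus_prob_def using tanh_real_bounds by (auto simp: add_pos_pos)
    (smt (verit) tanh_real_gt_neg1 tanh_real_lt_1)+

lemma plus_prob_bounds_le [simp]: "0 \<le> plus_prob i x" "plus_prob i x \<le> 1"
  using plus_prob_bounds[of i x] by simp_all

lemma expectation_update:
  "measure_pmf.expectation (update i x) f =
    f (x(i := 1)) * plus_prob i x + f (x(i := -1)) * (1 - plus_prob i x)"
  by (simp add: update_def)

lemma expectation_update_pair:
  "measure_pmf.expectation (update_pair i (x, y)) F =
    F (x(i := 1), y(i := 1)) * min (plus_prob i x) (plus_prob i y) +
    F (x(i := 1), y(i := -1)) * (plus_prob i x - min (plus_prob i x) (plus_prob i y)) +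
    F (x(i := -1), y(i := 1)) * (plus_prob i y - min (plus_prob i x) (plus_prob i y)) +
    F (x(i := -1), y(i := -1)) * (1 - max (plus_prob i x) (plus_prob i y))"
  by (simp add: update_pair_def expectation_bernoulli_pair plus_prob_bounds)

lemma finite_kernel_update: "finite_kernel (update i)"
  by (simp add: finite_kernel_def update_def finite_set_pmf_bool)

lemma finite_kernel_update_pair: "finite_kernel (update_pair i)"
proof -
  have "finite (set_pmf (p :: (bool \<times> bool) pmf))" for p
    by (rule finite_subset[OF subset_UNIV]) simp
  then show ?thesis by (simp add: finite_kernel_def update_pair_def)
qed

lemma couples_update: "couples (update_pair i) (update i)"
proof -
  have "map_pmf fst (update_pair i z) = update i (fst z)" for z
  proof -
    have "map_pmf fst (update_pair i z) = map_pmf (\<lambda>b. (fst z)(i := spin b))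
        (map_pmf fst (bernoulli_pair (plus_prob i (fst z)) (plus_prob i (snd z))))"
      by (simp add: update_pair_def pmf.map_comp o_def case_prod_unfold)
    then show ?thesis by (simp add: marginals_bernoulli_pair plus_prob_bounds update_def)
  qed
  moreover have "map_pmf snd (update_pair i z) = update i (snd z)" for z
  proof -
    have "map_pmf snd (update_pair i z) = map_pmf (\<lambda>b. (snd z)(i := spin b))
        (map_pmf snd (bernoulli_pair (plus_prob i (fst z)) (plus_prob i (snd z))))"
      by (simp add: update_pair_def pmf.map_comp o_def case_prod_unfold)
    then show ?thesis by (simp add: marginals_bernoulli_pair plus_prob_bounds update_def)
  qed
  ultimately show ?thesis by (simp add: couples_def)
qed

lemma set_update: "set_pmf (update i x) = {x(i := 1), x(i := -1)}"
proof -
  have "set_pmf (bernoulli_pmf (plus_prob i x)) = UNIV"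
    using plus_prob_bounds[of i x] by (auto simp: set_pmf_bernoulli)
  then show ?thesis by (auto simp: update_def UNIV_bool)
qed

lemma update_configs: "i \<in> {1..N} \<Longrightarrow> x \<in> configs N \<Longrightarrow> x(i := 1) \<in> configs N \<and> x(i := -1) \<in> configs N"
  by (auto simp: configs_def PiE_iff extensional_def)

lemma set_update_configs: "i \<in> {1..N} \<Longrightarrow> x \<in> configs N \<Longrightarrow> set_pmf (update i x) \<subseteq> configs N"
  using update_configs by (auto simp: set_update)

text \<open>Doubling the sum over pairs gives the square of the magnetization less its diagonal, and
  the diagonal is \<open>N\<close> because spins square to 1.\<close>

lemma cw_energy_eq:
  assumes "x \<in> configs N"
  shows "cw_energy N \<beta> h x =
    \<beta> / (2 * real N) * ((\<Sum>i=1..N. x i)\<^sup>2 - real N) + h * (\<Sum>i=1..N. x i)"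
proof -
  have "2 * (\<Sum>i=1..n. \<Sum>j\<in>{i<..n}. x i * x j) = (\<Sum>i=1..n. x i)\<^sup>2 - (\<Sum>i=1..n. (x i)\<^sup>2)" for n
  proof (induction n)
    case (Suc n)
    have "(\<Sum>i=1..Suc n. \<Sum>j\<in>{i<..Suc n}. x i * x j) =
      (\<Sum>i=1..n. (\<Sum>j\<in>{i<..n}. x i * x j) + x i * x (Suc n))"
    proof -
      have "{i<..Suc n} = insert (Suc n) {i<..n}" if "i \<le> n" for i
        using that by auto
      then show ?thesis by (simp add: add.commute)
    qed
    then show ?case
      using Suc by (simp add: sum.distrib power2_eq_square algebra_simps sum_distrib_left sum_distrib_right)
  qed simp
  from this[of N] have two: "2 * (\<Sum>i=1..N. \<Sum>j\<in>{i<..N}. x i * x j) = (\<Sum>i=1..N. x i)\<^sup>2 - (\<Sum>i=1..N. (x i)\<^sup>2)" .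
  have sq: "(\<Sum>i=1..N. (x i)\<^sup>2) = (\<Sum>i=1..N. 1)"
    using assms by (intro sum.cong) (auto simp: configs_def PiE_iff power2_eq_1_iff)
  have S: "(\<Sum>i=1..N. \<Sum>j\<in>{i<..N}. x i * x j) = ((\<Sum>i=1..N. x i)\<^sup>2 - real N) / 2"
    using two unfolding sq by simp
  show ?thesis unfolding cw_energy_def S by (simp add: mult.commute)
qed

text \<open>Conditioning leaves exactly two configurations, \<open>?u\<close> and \<open>?v\<close>;
  their relative weights are turned into \<open>plus_prob\<close> by
  \<open>tanh_exp_ratio\<close>.\<close>

lemma resample_eq_update:
  assumes i: "i \<in> {1..N}" and x: "x \<in> configs N"
  shows "resample N \<beta> h i x = update i x"
proof (rule pmf_eqI)
  fix w
  let ?A = "{\<omega>. \<forall>j\<in>{1..N} - {i}. \<omega> j = x j}"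
  let ?u = "x(i := 1)" and ?v = "x(i := -1)"
  let ?E = "cw_energy N \<beta> h" and ?Z = "cw_partition N \<beta> h"
  have uv: "?u \<in> configs N" "?v \<in> configs N" using update_configs[OF i x] by auto
  have ne: "?u \<noteq> ?v" by (metis fun_upd_same one_neq_neg_one)
  have int: "?A \<inter> configs N = {?u, ?v}"
  proof (intro equalityI subsetI)
    fix z assume z: "z \<in> ?A \<inter> configs N"
    have "z = x(i := z i)"
    proof
      fix j show "z j = (x(i := z i)) j"
        using z x i by (cases "j \<in> {1..N}") (auto simp: configs_def PiE_iff extensional_def)
    qed
    moreover have "z i = 1 \<or> z i = -1" using z i by (auto simp: configs_def PiE_iff)
    ultimately show "z \<in> {?u, ?v}" by (metis insertCI)
  qed (use uv in \<open>auto split: if_splits\<close>)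
  have Z: "?Z > 0" by (rule cw_partition_pos)
  have ne': "set_pmf (curie_weiss N \<beta> h) \<inter> ?A \<noteq> {}"
    using int by (auto simp: set_curie_weiss)
  have "measure (curie_weiss N \<beta> h) ?A = measure (curie_weiss N \<beta> h) {?u, ?v}"
    unfolding int[symmetric] by (subst measure_Int_set_pmf[symmetric]) (simp add: set_curie_weiss)
  also have "\<dots> = (exp (?E ?u) + exp (?E ?v)) / ?Z"
    using uv ne by (subst measure_measure_pmf_finite) (auto simp: pmf_curie_weiss add_divide_distrib)
  finally have m: "measure (curie_weiss N \<beta> h) ?A = (exp (?E ?u) + exp (?E ?v)) / ?Z" .
  let ?M = "\<Sum>j\<in>{1..N} - {i}. x j"
  have N: "real N > 0" using i by auto
  \<comment> \<open>With \<open>M\<close> the sum of the other spins, the squares (1 + M)^2 and (-1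
    + M)^2 differ by 4 M.\<close>
  have diff: "(?E ?u - ?E ?v) / 2 = \<beta> / real N * ?M + h"
  proof -
    have "(\<beta> / (2 * real N) * ((1 + M)\<^sup>2 - real N) + h * (1 + M) -
      (\<beta> / (2 * real N) * ((- 1 + M)\<^sup>2 - real N) + h * (- 1 + M))) / 2 = \<beta> / real N * M + h" for M
      using N by (simp add: field_simps power2_eq_square)
    then show ?thesis
      unfolding cw_energy_eq[OF uv(1)] cw_energy_eq[OF uv(2)] sum_fun_upd[OF finite_atLeastAtMost i] .
  qed
  have pu: "exp (?E ?u) / (exp (?E ?u) + exp (?E ?v)) = plus_prob i x"
    unfolding tanh_exp_ratio diff plus_prob_def ..
  have pv: "exp (?E ?v) / (exp (?E ?u) + exp (?E ?v)) = 1 - plus_prob i x"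
  proof -
    have "b / (a + b) = 1 - a / (a + b)" if "a > 0" "b > 0" for a b :: real
      using that by (simp add: field_simps)
    from this[OF exp_gt_zero exp_gt_zero] show ?thesis unfolding pu[symmetric] .
  qed
  have pup: "pmf (update i x) w = (if w = ?u then plus_prob i x else if w = ?v then 1 - plus_prob i x else 0)" for w
  proof -
    have inj: "inj (\<lambda>b. x(i := spin b))"
      by (rule injI) (metis fun_upd_same one_neq_neg_one spin_def)
    have "pmf (update i x) ?u = plus_prob i x" "pmf (update i x) ?v = 1 - plus_prob i x"
      using pmf_map_inj'[OF inj, of "bernoulli_pmf (plus_prob i x)" True]
        pmf_map_inj'[OF inj, of "bernoulli_pmf (plus_prob i x)" False]
      by (simp_all add: update_def)
    moreover have "pmf (update i x) w = 0" if "w \<notin> {?u, ?v}"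
      using that by (simp add: pmf_eq_0_set_pmf set_update)
    ultimately show ?thesis by auto
  qed
  show "pmf (resample N \<beta> h i x) w = pmf (update i x) w"
  proof (cases "w \<in> {?u, ?v}")
    case True
    then have "w \<in> ?A" "w \<in> configs N" using int by blast+
    then have "pmf (resample N \<beta> h i x) w = exp (?E w) / (exp (?E ?u) + exp (?E ?v))"
      unfolding resample_def pmf_cond[OF ne'] m pmf_curie_weiss using Z by simp
    with True ne show ?thesis
      by (elim insertE emptyE) (simp_all only: pup pu pv if_True if_False refl not_sym[OF ne])
  next
    case False
    then have "w \<notin> ?A \<or> w \<notin> configs N" using int by blast
    then have "pmf (resample N \<beta> h i x) w = 0"
    proof
      assume "w \<notin> ?A"
      then show ?thesis unfolding resample_def pmf_cond[OF ne'] by (rule if_not_P)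
    next
      assume "w \<notin> configs N"
      then show ?thesis unfolding resample_def pmf_cond[OF ne'] pmf_curie_weiss by simp
    qed
    then show ?thesis unfolding pup using False by simp
  qed
qed

end

section \<open>Curvature of the systemic scan\<close>

lemma couples_set:
  assumes "couples Q K" "w \<in> set_pmf (Q z)"
  shows "fst w \<in> set_pmf (K (fst z))" "snd w \<in> set_pmf (K (snd z))"
proof -
  have "map_pmf fst (Q z) = K (fst z)" "map_pmf snd (Q z) = K (snd z)"
    using assms(1) unfolding couples_def by blast+
  then show "fst w \<in> set_pmf (K (fst z))" "snd w \<in> set_pmf (K (snd z))"
    using assms(2) by (metis imageI set_map_pmf)+
qed

text \<open>A uniform contraction by \<open>c\<close> off the diagonal suffices: diagonal pairs
  carry the value 1, which is at least \<open>1 - c\<close> because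
  \<open>c \<ge> 0\<close>.\<close>

lemma ricci_ge:
  assumes "S \<noteq> {}" and d: "\<And>x y. x \<in> S \<Longrightarrow> y \<in> S \<Longrightarrow> x \<noteq> y \<Longrightarrow> d x y > 0"
    and W: "\<And>x y. x \<in> S \<Longrightarrow> y \<in> S \<Longrightarrow> x \<noteq> y \<Longrightarrow>
      wasserstein1 d (kernel_power P k x) (kernel_power P k y) \<le> c * d x y"
    and c: "c \<ge> 0"
  shows "ricci S d P k \<ge> 1 - c"
  unfolding ricci_def
proof (rule cINF_greatest)
  fix z assume "z \<in> S \<times> S"
  then obtain x y where z: "z = (x, y)" "x \<in> S" "y \<in> S" by auto
  show "1 - c \<le> (case z of (x, y) \<Rightarrow> ricci_pt d P k x y)"
  proof (cases "x = y")
    case False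
    then have "wasserstein1 d (kernel_power P k x) (kernel_power P k y) / d x y \<le> c"
      using W[of x y] d[of x y] z by (simp add: divide_le_eq)
    then show ?thesis using z False by (simp add: ricci_pt_def)
  qed (use z c in \<open>simp add: ricci_pt_def\<close>)
qed (use assms(1) in simp)

text \<open>The function x - tanh x has derivative tanh^2 x, hence is nondecreasing, and so is
  \<open>tanh\<close>.\<close>

lemma abs_tanh_diff_le: "\<bar>tanh a - tanh b\<bar> \<le> \<bar>a - b :: real\<bar>"
proof -
  have mono: "a - tanh a \<le> b - tanh b" if "a \<le> b" for a b :: real
  proof (rule DERIV_nonneg_imp_nondecreasing[OF that], intro exI conjI)
    fix x :: real
    show "((\<lambda>x. x - tanh x) has_real_derivative (1 - (1 - tanh x ^ 2))) (at x)"
      by (auto intro!: derivative_eq_intros)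
  qed simp
  have "\<bar>tanh a - tanh b\<bar> \<le> \<bar>a - b\<bar>" if "a \<le> b" for a b :: real
    using mono[OF that] that by (simp add: abs_if)
  then show ?thesis by (metis abs_minus_commute linear)
qed

text \<open>On spins this is the indicator of disagreement. The form by absolute values fits both
  the Lipschitz estimate and the later comparison by \<open>sup\<close> and
  \<open>inf\<close>.\<close>

definition gap :: "(nat \<Rightarrow> real) \<times> (nat \<Rightarrow> real) \<Rightarrow> nat \<Rightarrow> real" where
  "gap z j = \<bar>fst z j - snd z j\<bar> / 2"

definition err :: "((nat \<Rightarrow> real) \<times> (nat \<Rightarrow> real)) pmf \<Rightarrow> nat \<Rightarrow> real" where
  "err \<rho> j = measure_pmf.expectation \<rho> (\<lambda>z. gap z j)"

lemma gap_nonneg [simp]: "gap z j \<ge> 0"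
  by (simp add: gap_def)

lemma err_nonneg [simp]: "err \<rho> j \<ge> 0"
  unfolding err_def by (intro integral_nonneg_AE) simp

lemma err_return [simp]: "err (return_pmf z) j = gap z j"
  by (simp add: err_def)

lemma hamming_eq_gap:
  assumes "x \<in> configs N" "y \<in> configs N"
  shows "hamming N x y = (\<Sum>j=1..N. gap (x, y) j)"
proof -
  have "(\<Sum>j=1..N. gap (x, y) j) = (\<Sum>j=1..N. if x j \<noteq> y j then 1 else 0)"
  proof (intro sum.cong refl)
    fix j assume j: "j \<in> {1..N}"
    have "x j \<in> {-1, 1}" "y j \<in> {-1, 1}"
      using assms j unfolding configs_def by (blast dest: PiE_mem)+
    then show "gap (x, y) j = (if x j \<noteq> y j then 1 else 0)"
      by (auto simp: gap_def)
  qed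
  also have "\<dots> = hamming N x y"
    by (simp add: hamming_def sum.If_cases Int_def)
  finally show ?thesis ..
qed

lemma hamming_ge_1:
  assumes "x \<in> configs N" "y \<in> configs N" "x \<noteq> y"
  shows "hamming N x y \<ge> 1"
proof -
  have "\<exists>i\<in>{1..N}. x i \<noteq> y i"
  proof (rule ccontr)
    assume "\<not> ?thesis"
    then have "x = y" using assms by (intro PiE_ext) (auto simp: configs_def)
    then show False using assms(3) by simp
  qed
  then have "{i\<in>{1..N}. x i \<noteq> y i} \<noteq> {}" by auto
  then have "card {i\<in>{1..N}. x i \<noteq> y i} > 0" by (simp add: card_gt_0_iff del: Collect_empty_eq)
  then show ?thesis by (simp add: hamming_def)
qed

text \<open>The given kernel \<open>P\<close> is traded for its closed form \<open>K\<close>, for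
  which a coupling is available. The coupled pair stays in configurations, so its expected Hamming
  distance splits into the errors of the sites.\<close>

lemma wasserstein_hamming_le:
  assumes K: "\<And>x. x \<in> configs N \<Longrightarrow> P x = K x" "\<And>x. x \<in> configs N \<Longrightarrow> set_pmf (K x) \<subseteq> configs N"
    and Q: "couples Q K" "finite_kernel Q" and xy: "x \<in> configs N" "y \<in> configs N"
  shows "wasserstein1 (hamming N) (kernel_power P k x) (kernel_power P k y) \<le>
    (\<Sum>j=1..N. err (kernel_power Q k (x, y)) j)"
proof -

  have c: "couples (kernel_power Q k) (kernel_power K k)" by (rule couples_kernel_power[OF Q(1)])
  have "wasserstein1 (hamming N) (kernel_power P k x) (kernel_power P k y) =
    wasserstein1 (hamming N) (kernel_power K k x) (kernel_power K k y)"
    using kernel_power_cong[where P = P and Q = K, OF K] xy by simp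
  also have "\<dots> \<le> measure_pmf.expectation (kernel_power Q k (x, y)) (\<lambda>(x, y). hamming N x y)"
    by (rule wasserstein1_le_coupling[OF _ c]) (simp add: hamming_def)
  also have "\<dots> = measure_pmf.expectation (kernel_power Q k (x, y)) (\<lambda>z. \<Sum>j=1..N. gap z j)"
  proof (rule expectation_cong_pmf)
    fix w assume w: "w \<in> set_pmf (kernel_power Q k (x, y))"
    have "set_pmf (kernel_power K k x) \<subseteq> configs N" "set_pmf (kernel_power K k y) \<subseteq> configs N"
      using kernel_power_cong[where P = P and Q = K, OF K] xy by simp_all
    then have "fst w \<in> configs N" "snd w \<in> configs N"
      using couples_set[OF c w] by auto
    then show "(case w of (x, y) \<Rightarrow> hamming N x y) = (\<Sum>j=1..N. gap w j)"
      using hamming_eq_gap[of "fst w" N "snd w"] by (simp add: case_prod_unfold)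
  qed
  also have "\<dots> = (\<Sum>j=1..N. err (kernel_power Q k (x, y)) j)"
    unfolding err_def by (rule expectation_sum_finite) (rule finite_kernel_power[OF Q(2)])
  finally show ?thesis .
qed

section \<open>Propagation of disagreement along a scan\<close>

context glauber
begin

text \<open>The total influence on one site in Dobrushin's sense: at most \<open>\<beta> / N\<close>
  from each of the \<open>N - 1\<close> others.\<close>

definition theta :: real where
  "theta = \<beta> * ((real N - 1) / real N)"

lemma theta_nonneg: "theta \<ge> 0"
  using N_pos beta_pos by (simp add: theta_def)

text \<open>A disagreement shifts the field by \<open>2 * \<beta> / N\<close>, \<open>tanh\<close>
  does not enlarge the shift, and the factor 1/2 in \<open>plus_prob\<close> cancels the 2.\<close>

lemma plus_prob_lipschitz:
  "\<bar>plus_prob i x - plus_prob i y\<bar> \<le> \<beta> / real N * (\<Sum>j\<in>{1..N} - {i}. gap (x, y) j)"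
proof -
  let ?M = "\<lambda>x. \<Sum>j\<in>{1..N} - {i}. x j"
  have "\<bar>?M x - ?M y\<bar> \<le> (\<Sum>j\<in>{1..N} - {i}. \<bar>x j - y j\<bar>)"
    by (simp add: sum_subtractf[symmetric] sum_abs)
  also have "\<dots> = 2 * (\<Sum>j\<in>{1..N} - {i}. gap (x, y) j)"
    by (simp add: gap_def sum_divide_distrib[symmetric])
  finally have M: "\<bar>?M x - ?M y\<bar> \<le> 2 * (\<Sum>j\<in>{1..N} - {i}. gap (x, y) j)" .
  have "\<bar>plus_prob i x - plus_prob i y\<bar> =
      \<bar>tanh (\<beta> / real N * ?M x + h) - tanh (\<beta> / real N * ?M y + h)\<bar> / 2"
    by (simp add: plus_prob_def diff_divide_distrib[symmetric])
  also have "\<dots> \<le> \<bar>(\<beta> / real N * ?M x + h) - (\<beta> / real N * ?M y + h)\<bar> / 2"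
    by (intro divide_right_mono abs_tanh_diff_le) simp
  also have "(\<beta> / real N * ?M x + h) - (\<beta> / real N * ?M y + h) = \<beta> / real N * (?M x - ?M y)"
    by (simp add: algebra_simps)
  also have "\<bar>\<beta> / real N * (?M x - ?M y)\<bar> / 2 = \<beta> / real N * \<bar>?M x - ?M y\<bar> / 2"
    using beta_pos by (simp add: abs_mult)
  also have "\<dots> \<le> \<beta> / real N * (2 * (\<Sum>j\<in>{1..N} - {i}. gap (x, y) j)) / 2"
    using M beta_pos by (intro divide_right_mono mult_left_mono) auto
  finally show ?thesis by simp
qed

lemma expectation_gap_update_pair:
  "measure_pmf.expectation (update_pair i z) (\<lambda>w. gap w j) =
    (if j = i then \<bar>plus_prob i (fst z) - plus_prob i (snd z)\<bar> else gap z j)"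
proof (cases z)
  case (Pair x y)
  have "min p q + (p - min p q) + (q - min p q) + (1 - max p q) = 1" for p q :: real
    by (simp add: min_def max_def)
  from arg_cong[OF this, of "\<lambda>t. g * t" for g]
  have "g * min p q + g * (p - min p q) + g * (q - min p q) + g * (1 - max p q) = g" for p q g :: real
    by (simp add: ring_distribs)
  then show ?thesis
    unfolding Pair expectation_update_pair by (auto simp: gap_def min_def)
qed

lemma err_update:
  assumes "finite (set_pmf \<rho>)"
  shows "j \<noteq> i \<Longrightarrow> err (bind_pmf \<rho> (update_pair i)) j = err \<rho> j"
    and "err (bind_pmf \<rho> (update_pair i)) i \<le> \<beta> / real N * (\<Sum>j\<in>{1..N} - {i}. err \<rho> j)"
proof -
  have fin: "finite (set_pmf (update_pair i z))" for z
    using finite_kernel_update_pair unfolding finite_kernel_def by blast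
  show "j \<noteq> i \<Longrightarrow> err (bind_pmf \<rho> (update_pair i)) j = err \<rho> j"
    unfolding err_def by (simp add: expectation_bind_finite[OF assms fin] expectation_gap_update_pair)
  have "err (bind_pmf \<rho> (update_pair i)) i =
      measure_pmf.expectation \<rho> (\<lambda>z. \<bar>plus_prob i (fst z) - plus_prob i (snd z)\<bar>)"
    unfolding err_def by (simp add: expectation_bind_finite[OF assms fin] expectation_gap_update_pair)
  also have "\<dots> \<le> measure_pmf.expectation \<rho> (\<lambda>z. \<beta> / real N * (\<Sum>j\<in>{1..N} - {i}. gap z j))"
    using plus_prob_lipschitz by (intro expectation_mono_finite[OF assms]) auto
  also have "\<dots> = \<beta> / real N * (\<Sum>j\<in>{1..N} - {i}. err \<rho> j)"
    unfolding err_def expectation_sum_finite[OF assms, symmetric] by simp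
  finally show "err (bind_pmf \<rho> (update_pair i)) i \<le> \<beta> / real N * (\<Sum>j\<in>{1..N} - {i}. err \<rho> j)" .
qed

lemma finite_scan_pair: "finite (set_pmf \<rho>) \<Longrightarrow> finite (set_pmf (scan update_pair js \<rho>))"
  by (rule finite_scan[OF finite_kernel_update_pair])

text \<open>The new error at a visited site is at most \<open>\<beta> / N\<close> times
  \<open>N - 1\<close> errors, each at most \<open>M\<close>. As \<open>theta \<le> 1\<close>,
  visited sites stay below \<open>M\<close>, so the order is immaterial and sites may be visited
  repeatedly.\<close>

lemma err_scan_uniform:
  assumes fin: "finite (set_pmf \<rho>)" and th: "theta \<le> 1" and M: "M \<ge> 0"
    and js: "set js \<subseteq> {1..N}" and err: "\<And>j. j \<in> {1..N} \<Longrightarrow> err \<rho> j \<le> M"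
  shows "\<forall>j\<in>{1..N}. err (scan update_pair js \<rho>) j \<le> (if j \<in> set js then theta * M else M)"
  using js
proof (induction js rule: rev_induct)
  case (snoc i js)
  let ?\<rho> = "scan update_pair js \<rho>"
  have i: "i \<in> {1..N}" using snoc.prems by simp
  have thM: "theta * M \<le> M" using th M theta_nonneg by (simp add: mult_left_le_one_le)
  have IH: "err ?\<rho> j \<le> (if j \<in> set js then theta * M else M)" if "j \<in> {1..N}" for j
    using snoc that by simp
  have IH': "err ?\<rho> j \<le> M" if "j \<in> {1..N}" for j
    using IH[OF that] thM by (auto split: if_splits)
  have "(\<Sum>j\<in>{1..N} - {i}. err ?\<rho> j) \<le> (\<Sum>j\<in>{1..N} - {i}. M)"
    using IH' by (intro sum_mono) auto
  also have "\<dots> = (real N - 1) * M" using i by (simp add: of_nat_diff)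
  finally have "\<beta> / real N * (\<Sum>j\<in>{1..N} - {i}. err ?\<rho> j) \<le> theta * M"
    using mult_left_mono[of _ _ "\<beta> / real N"] beta_pos by (fastforce simp: theta_def)
  then have "err (bind_pmf ?\<rho> (update_pair i)) i \<le> theta * M"
    using err_update(2)[OF finite_scan_pair[OF fin], of js i] by linarith
  moreover have "err (bind_pmf ?\<rho> (update_pair i)) j \<le> (if j \<in> set js then theta * M else M)"
    if "j \<in> {1..N}" "j \<noteq> i" for j
    using err_update(1)[OF finite_scan_pair[OF fin] that(2)] IH[OF that(1)] by simp
  ultimately have "err (bind_pmf ?\<rho> (update_pair i)) j \<le> (if j = i \<or> j \<in> set js then theta * M else M)"
    if "j \<in> {1..N}" for j
    using that by (cases "j = i") auto
  then show ?case by simp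
qed (use err in auto)

text \<open>The unvisited sites keep their initial errors, which sum to at most \<open>D\<close>.
  Hence an update creates an error of at most \<open>a\<close> times the visited sum plus
  \<open>D\<close>, and this quantity grows by the factor \<open>1 + a\<close> per update.
  Distinctness of \<open>js\<close> ensures that each site enters the visited sum when its only
  update is made.\<close>

lemma err_scan_growth:
  assumes fin: "finite (set_pmf \<rho>)" and js: "set js \<subseteq> {1..N}" "distinct js"
  defines "D \<equiv> \<Sum>j=1..N. err \<rho> j" and "a \<equiv> \<beta> / real N"
  shows "(\<Sum>j\<in>set js. err (scan update_pair js \<rho>) j) + D \<le> (1 + a) ^ length js * D \<and>
    (\<forall>j. if j \<in> set js then err (scan update_pair js \<rho>) j \<le> a * (1 + a) ^ length js * D
      else err (scan update_pair js \<rho>) j = err \<rho> j)"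
  using js
proof (induction js rule: rev_induct)
  case (snoc i js)
  let ?\<rho> = "scan update_pair js \<rho>"
  have i: "i \<in> {1..N}" "i \<notin> set js" "set js \<subseteq> {1..N}" using snoc.prems by auto
  have a: "a \<ge> 0" using beta_pos by (simp add: a_def)
  have D: "D \<ge> 0" unfolding D_def by (simp add: sum_nonneg)
  have IH1: "(\<Sum>j\<in>set js. err ?\<rho> j) + D \<le> (1 + a) ^ length js * D"
    and IH2: "\<And>j. j \<in> set js \<Longrightarrow> err ?\<rho> j \<le> a * (1 + a) ^ length js * D"
    and IH3: "\<And>j. j \<notin> set js \<Longrightarrow> err ?\<rho> j = err \<rho> j"
    using snoc by (auto split: if_splits)
  have "(\<Sum>j\<in>{1..N} - {i}. err ?\<rho> j) \<le> (\<Sum>j\<in>{1..N}. err ?\<rho> j)"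
    by (intro sum_mono2) auto
  also have "\<dots> = (\<Sum>j\<in>set js. err ?\<rho> j) + (\<Sum>j\<in>{1..N} - set js. err ?\<rho> j)"
    using i by (subst sum.subset_diff[of "set js"]) auto
  also have "(\<Sum>j\<in>{1..N} - set js. err ?\<rho> j) = (\<Sum>j\<in>{1..N} - set js. err \<rho> j)"
    using IH3 by (intro sum.cong) auto
  also have "\<dots> \<le> D" unfolding D_def by (intro sum_mono2) auto
  finally have "(\<Sum>j\<in>{1..N} - {i}. err ?\<rho> j) \<le> (1 + a) ^ length js * D" using IH1 by linarith
  then have "a * (\<Sum>j\<in>{1..N} - {i}. err ?\<rho> j) \<le> a * ((1 + a) ^ length js * D)"
    using a by (intro mult_left_mono)
  then have new: "err (bind_pmf ?\<rho> (update_pair i)) i \<le> a * ((1 + a) ^ length js * D)"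
    using err_update(2)[OF finite_scan_pair[OF fin], of js i] unfolding a_def by linarith
  have old: "err (bind_pmf ?\<rho> (update_pair i)) j = err ?\<rho> j" if "j \<noteq> i" for j
    using err_update(1)[OF finite_scan_pair[OF fin] that] .
  have grow: "a * ((1 + a) ^ length js * D) \<le> a * (1 + a) ^ Suc (length js) * D"
  proof -
    have "(1 + a) ^ length js \<le> (1 + a) ^ Suc (length js)"
      using a by (intro power_increasing) auto
    then show ?thesis using a D by (simp add: mult.assoc mult_left_mono mult_right_mono del: power_Suc)
  qed
  have "(\<Sum>j\<in>set js. err (bind_pmf ?\<rho> (update_pair i)) j) = (\<Sum>j\<in>set js. err ?\<rho> j)"
    using i by (intro sum.cong refl old) auto
  then have "(\<Sum>j\<in>set (js @ [i]). err (bind_pmf ?\<rho> (update_pair i)) j) =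
      err (bind_pmf ?\<rho> (update_pair i)) i + (\<Sum>j\<in>set js. err ?\<rho> j)"
    using i by simp
  then have "(\<Sum>j\<in>set (js @ [i]). err (bind_pmf ?\<rho> (update_pair i)) j) + D \<le>
      a * ((1 + a) ^ length js * D) + (1 + a) ^ length js * D"
    using new IH1 by linarith
  also have "\<dots> = (1 + a) ^ length (js @ [i]) * D" by (simp add: algebra_simps)
  finally have 1: "(\<Sum>j\<in>set (js @ [i]). err (bind_pmf ?\<rho> (update_pair i)) j) + D \<le>
    (1 + a) ^ length (js @ [i]) * D" .
  have 2: "err (bind_pmf ?\<rho> (update_pair i)) j \<le> a * (1 + a) ^ length (js @ [i]) * D"
    if "j \<in> set (js @ [i])" for j
  proof (cases "j = i")
    case False
    then have "err ?\<rho> j \<le> a * ((1 + a) ^ length js * D)"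
      using that IH2[of j] by (simp add: mult.assoc)
    then show ?thesis using old[OF False] grow by simp
  qed (use new grow in simp)
  show ?case using 1 2 old IH3 by simp
qed (simp add: D_def)

lemma one_plus_power_le_exp: "(1 + \<beta> / real N) ^ N \<le> exp \<beta>"
proof -
  have "(1 + \<beta> / real N) ^ N \<le> exp (\<beta> / real N) ^ N"
    using beta_pos by (intro power_mono exp_ge_add_one_self) (auto simp: add_nonneg_nonneg)
  also have "\<dots> = exp \<beta>" using N_pos by (simp add: exp_of_nat_mult[symmetric])
  finally show ?thesis .
qed

section \<open>Contraction over full sweeps\<close>

definition sweep :: "(nat \<Rightarrow> real) \<Rightarrow> (nat \<Rightarrow> real) pmf" where
  "sweep x = scan update [1..<Suc N] (return_pmf x)"

definition sweep_pair ::
  "(nat \<Rightarrow> real) \<times> (nat \<Rightarrow> real) \<Rightarrow> ((nat \<Rightarrow> real) \<times> (nat \<Rightarrow> real)) pmf" where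
  "sweep_pair z = scan update_pair [1..<Suc N] (return_pmf z)"

lemma set_sites: "set [1..<Suc N] = {1..N}"
  by auto

lemma systemic_scan_eq:
  assumes "x \<in> configs N"
  shows "systemic_scan N \<beta> h x = sweep x" "set_pmf (sweep x) \<subseteq> configs N"
  using scan_cong[where S = "configs N" and js = "[1..<Suc N]" and U = "resample N \<beta> h" and V = update
      and \<mu> = "return_pmf x"] assms resample_eq_update set_update_configs
  unfolding systemic_scan_def sweep_def scan_def[symmetric] set_sites by auto

lemma couples_sweep: "couples sweep_pair sweep"
  unfolding sweep_pair_def sweep_def by (rule couples_scan[OF couples_update])

lemma finite_kernel_sweep_pair: "finite_kernel sweep_pair"
  by (simp add: finite_kernel_def sweep_pair_def finite_scan_pair)

lemma bind_sweep_pair: "bind_pmf \<rho> sweep_pair = scan update_pair [1..<Suc N] \<rho>"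
  unfolding sweep_pair_def by (rule scan_bind)

lemma wasserstein_sweep_le:
  "x \<in> configs N \<Longrightarrow> y \<in> configs N \<Longrightarrow>
    wasserstein1 (hamming N) (kernel_power (systemic_scan N \<beta> h) k x)
      (kernel_power (systemic_scan N \<beta> h) k y) \<le> (\<Sum>j=1..N. err (kernel_power sweep_pair k (x, y)) j)"
  by (rule wasserstein_hamming_le) (use systemic_scan_eq couples_sweep finite_kernel_sweep_pair in auto)

lemma hamming_pos: "x \<in> configs N \<Longrightarrow> y \<in> configs N \<Longrightarrow> x \<noteq> y \<Longrightarrow> hamming N x y > 0"
  using hamming_ge_1[of x N y] by linarith

text \<open>The first bound gives the one-step curvature; the second turns the initial distance into
  a bound that is uniform over the sites, as the later sweeps require.\<close>

lemma err_sweep_one: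
  fixes z :: "(nat \<Rightarrow> real) \<times> (nat \<Rightarrow> real)"
  defines "D \<equiv> \<Sum>j=1..N. gap z j"
  shows "(\<Sum>j=1..N. err (kernel_power sweep_pair 1 z) j) \<le> (exp \<beta> - 1) * D"
    and "j \<in> {1..N} \<Longrightarrow> err (kernel_power sweep_pair 1 z) j \<le> \<beta> / real N * exp \<beta> * D"
proof -
  have kp: "kernel_power sweep_pair 1 z = scan update_pair [1..<Suc N] (return_pmf z)"
    unfolding kernel_power_1 sweep_pair_def ..
  have D: "D \<ge> 0" by (simp add: D_def sum_nonneg)
  have e: "(1 + \<beta> / real N) ^ N * D \<le> exp \<beta> * D"
    using one_plus_power_le_exp D by (rule mult_right_mono)
  have g: "(\<Sum>j=1..N. err (scan update_pair [1..<Suc N] (return_pmf z)) j) + D \<le> (1 + \<beta> / real N) ^ N * D"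
    "\<And>j. j \<in> {1..N} \<Longrightarrow> err (scan update_pair [1..<Suc N] (return_pmf z)) j \<le>
      \<beta> / real N * (1 + \<beta> / real N) ^ N * D"
    using err_scan_growth[of "return_pmf z" "[1..<Suc N]"] unfolding set_sites err_return D_def[symmetric]
    by (simp_all del: upt_Suc One_nat_def split: if_splits)
  show "(\<Sum>j=1..N. err (kernel_power sweep_pair 1 z) j) \<le> (exp \<beta> - 1) * D"
    unfolding kp using g(1) e by (simp add: algebra_simps del: upt_Suc)
  have "\<beta> / real N * ((1 + \<beta> / real N) ^ N * D) \<le> \<beta> / real N * (exp \<beta> * D)"
    using e beta_pos by (intro mult_left_mono) auto
  then show "j \<in> {1..N} \<Longrightarrow> err (kernel_power sweep_pair 1 z) j \<le> \<beta> / real N * exp \<beta> * D"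
    unfolding kp using g(2)[of j] by (simp add: mult.assoc del: upt_Suc)
qed

lemma kappa_ss_1_ge: "kappa_ss N \<beta> h 1 \<ge> 2 - exp \<beta>"
proof -
  have "kappa_ss N \<beta> h 1 \<ge> 1 - (exp \<beta> - 1)"
  proof (rule ricci_ge[OF configs_nonempty hamming_pos])
    fix x y assume xy: "x \<in> configs N" "y \<in> configs N"
    show "wasserstein1 (hamming N) (kernel_power (systemic_scan N \<beta> h) 1 x)
      (kernel_power (systemic_scan N \<beta> h) 1 y) \<le> (exp \<beta> - 1) * hamming N x y"
      using wasserstein_sweep_le[OF xy, of 1] err_sweep_one(1)[of "(x, y)"] hamming_eq_gap[OF xy] by simp
  qed (use beta_pos in auto)
  then show ?thesis by simp
qed

text \<open>The first sweep makes the errors uniform at the cost of the factor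
  \<open>\<beta> / N * exp \<beta>\<close>; each of the \<open>k\<close> later ones contracts the
  maximum by \<open>theta\<close>.\<close>

lemma err_sweep_power:
  assumes th: "theta \<le> 1"
  shows "j \<in> {1..N} \<Longrightarrow> err (kernel_power sweep_pair (Suc k) z) j \<le>
    theta ^ k * (\<beta> / real N * exp \<beta> * (\<Sum>j=1..N. gap z j))"
proof (induction k arbitrary: j)
  case 0
  then show ?case using err_sweep_one(2)[of j z] by (simp add: del: kernel_power_Suc)
next
  case (Suc k)
  let ?B = "\<beta> / real N * exp \<beta> * (\<Sum>j=1..N. gap z j)"
  have "?B \<ge> 0" using beta_pos by (simp add: sum_nonneg)
  then have "theta ^ k * ?B \<ge> 0" by (rule mult_nonneg_nonneg[OF zero_le_power[OF theta_nonneg]])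
  then have "\<forall>j\<in>{1..N}. err (scan update_pair [1..<Suc N] (kernel_power sweep_pair (Suc k) z)) j \<le>
    (if j \<in> set [1..<Suc N] then theta * (theta ^ k * ?B) else theta ^ k * ?B)"
    using Suc.IH set_sites
    by (intro err_scan_uniform th finite_kernel_power finite_kernel_sweep_pair) blast+
  then show ?case
    using Suc.prems by (subst kernel_power_Suc) (simp add: bind_sweep_pair set_sites mult.assoc del: upt_Suc kernel_power_Suc)
qed

lemma kappa_ss_ge:
  assumes k: "k \<ge> 2" and th: "theta \<le> 1"
  shows "kappa_ss N \<beta> h k \<ge> 1 - \<beta> * exp \<beta> * theta ^ (k - 1)"
proof (rule ricci_ge[OF configs_nonempty hamming_pos])
  fix x y assume xy: "x \<in> configs N" "y \<in> configs N"
  have "(\<Sum>j=1..N. err (kernel_power sweep_pair (Suc (k - 1)) (x, y)) j) \<le>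
    (\<Sum>j=1..N. theta ^ (k - 1) * (\<beta> / real N * exp \<beta> * (\<Sum>j=1..N. gap (x, y) j)))"
    by (intro sum_mono err_sweep_power th)
  \<comment> \<open>Summing over the \<open>N\<close> sites cancels the \<open>1 / N\<close> in the
    bound for a single site.\<close>
  also have "\<dots> = \<beta> * exp \<beta> * theta ^ (k - 1) * (\<Sum>j=1..N. gap (x, y) j)"
    using N_pos by simp
  finally show "wasserstein1 (hamming N) (kernel_power (systemic_scan N \<beta> h) k x)
      (kernel_power (systemic_scan N \<beta> h) k y) \<le> \<beta> * exp \<beta> * theta ^ (k - 1) * hamming N x y"
    using wasserstein_sweep_le[OF xy, of k] hamming_eq_gap[OF xy] k by (simp del: kernel_power_Suc)
qed (use beta_pos theta_nonneg in auto)

end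

section \<open>Pseudo spectral gap of the systemic scan\<close>

text \<open>Peels off the first update where \<open>scan_snoc\<close> peels off the last;
  \<open>scan_reversed\<close> needs one on each side.\<close>

lemma scan_Cons: "scan U (i # js) (return_pmf x) = bind_pmf (U i x) (\<lambda>z. scan U js (return_pmf z))"
proof -
  have "scan U (i # js) (return_pmf x) = scan U js (U i x)"
    by (simp add: scan_def bind_return_pmf)
  then show ?thesis by (simp add: scan_bind)
qed

lemma pmf_bind_finite:
  assumes "finite S" "set_pmf p \<subseteq> S"
  shows "pmf (bind_pmf p K) y = (\<Sum>z\<in>S. pmf p z * pmf (K z) y)"
  unfolding pmf_bind using assms by (subst integral_measure_pmf_real[where A = S]) (auto simp: mult.commute)

text \<open>Evaluate the eigenvalue equation where |f| is maximal: averaging cannot exceed the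
  maximum. Since \<open>f\<close> vanishes outside \<open>S\<close>, this maximum is global,
  wherever \<open>Q\<close> moves.\<close>

lemma eigenvalue_abs_le_1:
  assumes "finite S" and l: "kernel_eigenvalue S Q l"
  shows "\<bar>l\<bar> \<le> 1"
proof -
  obtain f x0 where f: "f \<in> eigenspace S Q l" and x0: "f x0 \<noteq> 0"
    using l by (auto simp: kernel_eigenvalue_def)
  have out: "\<And>x. x \<notin> S \<Longrightarrow> f x = 0" and ev: "\<And>x. x \<in> S \<Longrightarrow> measure_pmf.expectation (Q x) f = l * f x"
    using f by (auto simp: eigenspace_def)
  have "x0 \<in> S" using x0 out by blast
  then have "(\<lambda>x. \<bar>f x\<bar>) ` S \<noteq> {}" by blast
  then have "Max ((\<lambda>x. \<bar>f x\<bar>) ` S) \<in> (\<lambda>x. \<bar>f x\<bar>) ` S"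
    using assms(1) by (intro Max_in) auto
  then obtain x where x: "x \<in> S" "Max ((\<lambda>x. \<bar>f x\<bar>) ` S) = \<bar>f x\<bar>" by blast
  have le: "\<bar>f y\<bar> \<le> \<bar>f x\<bar>" for y
  proof (cases "y \<in> S")
    case True
    then show ?thesis using assms(1) Max_ge[of "(\<lambda>x. \<bar>f x\<bar>) ` S" "\<bar>f y\<bar>"] x(2) by auto
  qed (simp add: out)
  have "\<bar>l\<bar> * \<bar>f x\<bar> \<le> \<bar>f x\<bar>"
    using abs_expectation_le[where f = f and B = "\<bar>f x\<bar>" and p = "Q x"] le ev[OF x(1)] by (simp add: abs_mult)
  moreover have "\<bar>f x\<bar> > 0" using le[of x0] x0 by linarith
  ultimately show ?thesis by simp
qed

text \<open>Crude bounds: the upper one makes the supremum over \<open>k\<close> a supremum of a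
  bounded set, the lower one settles the case \<open>theta \<ge> 1\<close>.\<close>

lemma spectral_gap_bounds:
  assumes "finite S"
  shows "0 \<le> spectral_gap S Q" "spectral_gap S Q \<le> 2"
proof -
  define E where "E = {l. kernel_eigenvalue S Q l \<and> l \<noteq> 0 \<and> l \<noteq> 1}"
  have E: "l \<in> E \<Longrightarrow> -1 \<le> l \<and> l \<le> 1" for l
    using eigenvalue_abs_le_1[OF assms, of Q l] by (auto simp: E_def abs_le_iff)
  then have bdd: "bdd_above E" by (intro bdd_aboveI[where M = 1]) auto
  have "E \<noteq> {} \<Longrightarrow> Sup E \<le> 1" using E by (intro cSup_least) auto
  moreover have "-1 \<le> Sup E" if "E \<noteq> {}"
  proof -
    obtain l where l: "l \<in> E" using \<open>E \<noteq> {}\<close> by blast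
    then show ?thesis using E[OF l] cSup_upper[OF l bdd] by linarith
  qed
  ultimately show "0 \<le> spectral_gap S Q" "spectral_gap S Q \<le> 2"
    unfolding spectral_gap_def E_def[symmetric] Let_def by auto
qed

lemma vector_space_fun: "vector_space (\<lambda>(c :: real) (f :: 'a \<Rightarrow> real) x. c * f x)"
  by unfold_locales (auto simp: fun_eq_iff algebra_simps)

lemma dim_scaled_line:
  fixes f :: "'a \<Rightarrow> real"
  assumes "f x \<noteq> 0" and V: "V = {\<lambda>x. c * f x | c. True}"
  shows "vector_space.dim (\<lambda>c f x. c * f x) V = 1"
proof -
  interpret vector_space "\<lambda>(c :: real) (f :: 'a \<Rightarrow> real) x. c * f x" by (rule vector_space_fun)
  have "f \<noteq> 0" using assms(1) by auto
  then have ind: "independent {f}" by simp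
  have "span {f} = V" unfolding span_singleton V by auto
  then have "dim V = card {f}"
    using dim_eq_card[OF _ ind, of V] span_span by metis
  then show ?thesis by simp
qed

section \<open>Reversing the systemic scan\<close>

context glauber
begin

lemma pmf_curie_weiss_pos: "x \<in> configs N \<Longrightarrow> pmf (curie_weiss N \<beta> h) x > 0"
  by (rule pmf_positive) (simp add: set_curie_weiss)

text \<open>If \<open>x\<close> and \<open>y\<close> agree off \<open>i\<close>, they condition on
  the same event \<open>?A\<close>, and both sides are the product of the two weights divided by its
  probability. Otherwise both sides are 0.\<close>

lemma update_reversible:
  assumes i: "i \<in> {1..N}" and x: "x \<in> configs N" and y: "y \<in> configs N"
  shows "pmf (curie_weiss N \<beta> h) x * pmf (update i x) y = pmf (curie_weiss N \<beta> h) y * pmf (update i y) x"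
proof -
  let ?A = "\<lambda>x. {\<omega>. \<forall>j\<in>{1..N} - {i}. \<omega> j = x j}"
  have ne: "set_pmf (curie_weiss N \<beta> h) \<inter> ?A x \<noteq> {}" if "x \<in> configs N" for x :: "nat \<Rightarrow> real"
    using that by (auto simp: set_curie_weiss)
  have p: "pmf (update i x) y =
      (if y \<in> ?A x then pmf (curie_weiss N \<beta> h) y / measure (curie_weiss N \<beta> h) (?A x) else 0)"
    if "x \<in> configs N" for x y
    unfolding resample_eq_update[OF i that, symmetric] resample_def by (rule pmf_cond[OF ne[OF that]])
  show ?thesis
  proof (cases "y \<in> ?A x")
    case True
    then have "\<forall>j\<in>{1..N} - {i}. y j = x j" by simp
    then have "?A y = ?A x" "x \<in> ?A y" by simp_all
    then show ?thesis using True by (simp add: p[OF x] p[OF y])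
  next
    case False
    then have x': "x \<notin> ?A y" by (auto dest: sym)
    show ?thesis unfolding p[OF x] p[OF y] if_not_P[OF False] if_not_P[OF x'] by simp
  qed
qed

lemma set_scan_configs:
  assumes "set js \<subseteq> {1..N}" "x \<in> configs N"
  shows "set_pmf (scan update js (return_pmf x)) \<subseteq> configs N"
proof (rule scan_cong[where U = update, THEN conjunct2])
  show "set_pmf (update i z) \<subseteq> configs N" if "i \<in> set js" "z \<in> configs N" for i z
    using that assms(1) by (intro set_update_configs) auto
qed (use assms(2) in auto)

text \<open>Detailed balance holds for each single update; moving the stationary weight through the
  updates one by one reverses their order.\<close>

lemma scan_reversed:
  assumes "set js \<subseteq> {1..N}" "x \<in> configs N" "y \<in> configs N"
  shows "pmf (curie_weiss N \<beta> h) x * pmf (scan update js (return_pmf x)) y =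
    pmf (curie_weiss N \<beta> h) y * pmf (scan update (rev js) (return_pmf y)) x"
  using assms
proof (induction js arbitrary: y rule: rev_induct)
  case Nil
  then show ?case by (simp add: indicator_def)
next
  case (snoc i js)
  let ?\<pi> = "pmf (curie_weiss N \<beta> h)"
  have i: "i \<in> {1..N}" and js: "set js \<subseteq> {1..N}" using snoc.prems by auto
  have "?\<pi> x * pmf (scan update (js @ [i]) (return_pmf x)) y =
      (\<Sum>z\<in>configs N. ?\<pi> x * pmf (scan update js (return_pmf x)) z * pmf (update i z) y)"
    unfolding scan_snoc pmf_bind_finite[OF finite_configs set_scan_configs[OF js snoc.prems(2)]]
      sum_distrib_left by (simp add: mult.assoc)
  also have "\<dots> = (\<Sum>z\<in>configs N. ?\<pi> y * (pmf (update i y) z * pmf (scan update (rev js) (return_pmf z)) x))"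
  proof (intro sum.cong refl)
    fix z assume z: "z \<in> configs N"
    have "?\<pi> x * pmf (scan update js (return_pmf x)) z * pmf (update i z) y =
        (?\<pi> z * pmf (update i z) y) * pmf (scan update (rev js) (return_pmf z)) x"
      using snoc.IH[OF js snoc.prems(2) z] by simp
    then show "?\<pi> x * pmf (scan update js (return_pmf x)) z * pmf (update i z) y =
        ?\<pi> y * (pmf (update i y) z * pmf (scan update (rev js) (return_pmf z)) x)"
      using update_reversible[OF i z snoc.prems(3)] by simp
  qed
  also have "\<dots> = ?\<pi> y * pmf (scan update (rev (js @ [i])) (return_pmf y)) x"
    unfolding rev_append rev.simps append.simps scan_Cons
      pmf_bind_finite[OF finite_configs set_update_configs[OF i snoc.prems(3)]] sum_distrib_left ..
  finally show ?case .
qed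

lemma set_sites_rev: "set (rev [1..<Suc N]) = {1..N}"
  by auto

text \<open>Summing \<open>scan_reversed\<close> over the starting point gives the weight of
  \<open>y\<close> times the total mass of the reversed scan from \<open>y\<close>, which is
  1.\<close>

lemma systemic_scan_stationary: "bind_pmf (curie_weiss N \<beta> h) (systemic_scan N \<beta> h) = curie_weiss N \<beta> h"
proof (rule pmf_eqI)
  fix y
  let ?\<pi> = "pmf (curie_weiss N \<beta> h)"
  have S: "bind_pmf (curie_weiss N \<beta> h) (systemic_scan N \<beta> h) = bind_pmf (curie_weiss N \<beta> h) sweep"
    using systemic_scan_eq(1) by (auto intro!: bind_pmf_cong simp: set_curie_weiss)
  show "pmf (bind_pmf (curie_weiss N \<beta> h) (systemic_scan N \<beta> h)) y = ?\<pi> y"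
  proof (cases "y \<in> configs N")
    case True
    let ?R = "scan update (rev [1..<Suc N]) (return_pmf y)"
    have "pmf (bind_pmf (curie_weiss N \<beta> h) sweep) y = (\<Sum>z\<in>configs N. ?\<pi> z * pmf (sweep z) y)"
      by (rule pmf_bind_finite[OF finite_configs]) (simp add: set_curie_weiss)
    also have "\<dots> = (\<Sum>z\<in>configs N. ?\<pi> y * pmf ?R z)"
      unfolding sweep_def using True by (intro sum.cong refl scan_reversed) auto
    also have "\<dots> = ?\<pi> y * (\<Sum>z\<in>configs N. pmf ?R z)" by (simp add: sum_distrib_left)
    also have "(\<Sum>z\<in>configs N. pmf ?R z) = 1"
      by (rule sum_pmf_eq_1[OF finite_configs set_scan_configs]) (use True set_sites_rev in auto)
    finally show ?thesis unfolding S by simp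
  next
    case False
    have "set_pmf (bind_pmf (curie_weiss N \<beta> h) sweep) \<subseteq> configs N"
      using systemic_scan_eq(2) by (auto simp: set_curie_weiss)
    then have "pmf (bind_pmf (curie_weiss N \<beta> h) sweep) y = 0"
      using False by (auto simp: pmf_eq_0_set_pmf)
    then show ?thesis unfolding S using False by (simp add: pmf_curie_weiss)
  qed
qed

lemma time_reversal_systemic_scan:
  assumes "x \<in> configs N"
  shows "time_reversal (curie_weiss N \<beta> h) (systemic_scan N \<beta> h) x = scan update (rev [1..<Suc N]) (return_pmf x)"
proof (rule pmf_eqI)
  fix y
  let ?\<pi> = "pmf (curie_weiss N \<beta> h)" and ?R = "scan update (rev [1..<Suc N]) (return_pmf x)"
  have *: "pmf (time_reversal (curie_weiss N \<beta> h) (systemic_scan N \<beta> h) x) y =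
      ?\<pi> y * pmf (systemic_scan N \<beta> h y) x / ?\<pi> x"
    using assms by (intro pmf_time_reversal systemic_scan_stationary) (simp add: set_curie_weiss)
  show "pmf (time_reversal (curie_weiss N \<beta> h) (systemic_scan N \<beta> h) x) y = pmf ?R y"
  proof (cases "y \<in> configs N")
    case True
    have "?\<pi> y * pmf (sweep y) x = ?\<pi> x * pmf ?R y"
      unfolding sweep_def using True assms by (intro scan_reversed) auto
    then show ?thesis
      unfolding * systemic_scan_eq(1)[OF True] using pmf_curie_weiss_pos[OF assms] by simp
  next
    case False
    then have "pmf ?R y = 0"
      using set_scan_configs[OF _ assms, of "rev [1..<Suc N]"] set_sites_rev
      by (auto simp: pmf_eq_0_set_pmf simp del: upt_Suc)
    then show ?thesis unfolding * using False by (simp add: pmf_curie_weiss)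
  qed
qed

section \<open>Spectral gap of the double sweep\<close>

definition there_and_back :: "nat list" where
  "there_and_back = rev [1..<Suc N] @ [1..<Suc N]"

lemma set_there_and_back: "set there_and_back = {1..N}"
  unfolding there_and_back_def by auto

abbreviation double_sweep :: "(nat \<Rightarrow> real) \<Rightarrow> (nat \<Rightarrow> real) pmf" where
  "double_sweep x \<equiv> scan update there_and_back (return_pmf x)"

text \<open>The term \<open>k = 1\<close> of the pseudo spectral gap is again a scan along a list of
  sites, so the error estimates for scans apply to it.\<close>

lemma reversal_then_scan_eq:
  assumes "x \<in> configs N"
  shows "bind_pmf (kernel_power (time_reversal (curie_weiss N \<beta> h) (systemic_scan N \<beta> h)) 1 x)
    (kernel_power (systemic_scan N \<beta> h) 1) = double_sweep x"
proof -
  have "bind_pmf (kernel_power (time_reversal (curie_weiss N \<beta> h) (systemic_scan N \<beta> h)) 1 x)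
      (kernel_power (systemic_scan N \<beta> h) 1) =
    bind_pmf (scan update (rev [1..<Suc N]) (return_pmf x)) sweep"
    unfolding kernel_power_1 time_reversal_systemic_scan[OF assms]
    using set_scan_configs[OF _ assms, of "rev [1..<Suc N]"] set_sites_rev
    by (intro bind_pmf_cong refl systemic_scan_eq(1)) blast
  then show ?thesis
    unfolding sweep_def scan_bind there_and_back_def scan_append .
qed

text \<open>\<open>err_scan_uniform\<close> accepts lists with repetitions and yields one factor
  \<open>theta\<close> for each double sweep.\<close>

lemma err_double_sweep_power:
  assumes th: "theta \<le> 1" and z: "\<And>j. j \<in> {1..N} \<Longrightarrow> gap z j \<le> 1"
  defines "Q \<equiv> \<lambda>z. scan update_pair there_and_back (return_pmf z)"
  shows "j \<in> {1..N} \<Longrightarrow> err (kernel_power Q k z) j \<le> theta ^ k"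
proof (induction k arbitrary: j)
  case 0
  then show ?case using z by simp
next
  case (Suc k)
  have Q: "finite_kernel Q" by (simp add: finite_kernel_def Q_def finite_scan_pair)
  have b: "bind_pmf \<rho> Q = scan update_pair there_and_back \<rho>" for \<rho>
    unfolding Q_def by (rule scan_bind)
  have "\<forall>j\<in>{1..N}. err (scan update_pair there_and_back (kernel_power Q k z)) j \<le>
    (if j \<in> set there_and_back then theta * theta ^ k else theta ^ k)"
    using Suc.IH theta_nonneg set_there_and_back
    by (intro err_scan_uniform th finite_kernel_power Q) auto
  then show ?case using Suc.prems set_there_and_back by (simp add: b)
qed

text \<open>After \<open>k\<close> double sweeps the difference of the two expectations of
  \<open>f\<close> is l^k (f x - f y), while the coupling bounds it by a constant times theta^k.
  Since \<open>theta < l\<close>, letting \<open>k\<close> grow forces equality.\<close>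

lemma eigenfunction_constant:
  assumes th: "theta < l" "theta \<le> 1" and f: "f \<in> eigenspace (configs N) double_sweep l"
    and xy: "x \<in> configs N" "y \<in> configs N"
  shows "f x = f y"
proof -
  let ?P = "kernel_power double_sweep"
  define Q where "Q = (\<lambda>z. scan update_pair there_and_back (return_pmf z))"
  have l: "l > 0" using th theta_nonneg by linarith
  have ev: "x \<in> configs N \<Longrightarrow> measure_pmf.expectation (double_sweep x) f = l * f x" for x
    using f by (simp add: eigenspace_def)
  have fin: "finite_kernel double_sweep" "finite_kernel Q"
    by (simp_all add: finite_kernel_def Q_def finite_scan_pair finite_scan[OF finite_kernel_update])
  have sub: "set_pmf (?P k x) \<subseteq> configs N" if "x \<in> configs N" for k x
  proof (rule kernel_power_cong[where P = double_sweep, THEN conjunct2])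
    show "set_pmf (double_sweep z) \<subseteq> configs N" if "z \<in> configs N" for z
      using that set_there_and_back by (intro set_scan_configs) auto
  qed (rule refl that)+
  have pow: "measure_pmf.expectation (?P k x) f = l ^ k * f x" if "x \<in> configs N" for k x
  proof (induction k)
    case (Suc k)
    have "measure_pmf.expectation (?P (Suc k) x) f =
        measure_pmf.expectation (?P k x) (\<lambda>y. measure_pmf.expectation (double_sweep y) f)"
      unfolding kernel_power_Suc
      by (intro expectation_bind_finite finite_kernel_power finite_kernelD[OF fin(1)] fin)
    also have "\<dots> = measure_pmf.expectation (?P k x) (\<lambda>y. l * f y)"
      using sub[OF that] ev by (intro expectation_cong_pmf) blast
    finally show ?case using Suc by simp
  qed simp
  have c: "couples (kernel_power Q k) (?P k)" for k
    unfolding Q_def by (intro couples_kernel_power couples_scan couples_update)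
  define B where "B = (\<Sum>x\<in>configs N. \<bar>f x\<bar>)"
  have B: "\<bar>f x\<bar> \<le> B" if "x \<in> configs N" for x
    unfolding B_def by (rule member_le_sum[OF that _ finite_configs]) simp
  have B0: "B \<ge> 0" by (simp add: B_def sum_nonneg)
  have bound: "l ^ k * \<bar>f x - f y\<bar> \<le> 2 * B * real N * theta ^ k" for k
  proof -
    let ?\<rho> = "kernel_power Q k (x, y)"
    have fr: "finite (set_pmf ?\<rho>)" by (rule finite_kernel_power[OF fin(2)])
    have m: "map_pmf fst ?\<rho> = ?P k x" "map_pmf snd ?\<rho> = ?P k y"
      using c[of k] by (simp_all add: couples_def)
    have "l ^ k * (f x - f y) = measure_pmf.expectation ?\<rho> (\<lambda>w. f (fst w)) - measure_pmf.expectation ?\<rho> (\<lambda>w. f (snd w))"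
      using pow[OF xy(1), of k] pow[OF xy(2), of k] unfolding m[symmetric] by (simp add: right_diff_distrib)
    also have "\<dots> = measure_pmf.expectation ?\<rho> (\<lambda>w. f (fst w) - f (snd w))"
      by (intro Bochner_Integration.integral_diff[symmetric] integrable_measure_pmf_finite fr)
    finally have "\<bar>l ^ k * (f x - f y)\<bar> \<le> measure_pmf.expectation ?\<rho> (\<lambda>w. \<bar>f (fst w) - f (snd w)\<bar>)"
      by (simp only: integral_abs_bound)
    \<comment> \<open>Two distinct configurations disagree in at least one site, so the trivial
      bound \<open>2 * B\<close> may be multiplied by the number of disagreements.\<close>
    also have "\<dots> \<le> measure_pmf.expectation ?\<rho> (\<lambda>w. 2 * B * (\<Sum>j=1..N. gap w j))"
    proof (rule expectation_mono_finite[OF fr])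
      fix w assume w\<rho>: "w \<in> set_pmf ?\<rho>"
      have w: "fst w \<in> configs N" "snd w \<in> configs N"
        using couples_set[OF c w\<rho>] sub[OF xy(1)] sub[OF xy(2)] unfolding fst_conv snd_conv by blast+
      show "\<bar>f (fst w) - f (snd w)\<bar> \<le> 2 * B * (\<Sum>j=1..N. gap w j)"
      proof (cases "fst w = snd w")
        case True
        then show ?thesis using B0 by (simp add: sum_nonneg)
      next
        case False
        then have "1 \<le> (\<Sum>j=1..N. gap w j)"
          using hamming_ge_1[OF w False] hamming_eq_gap[OF w] by simp
        then have "2 * B * 1 \<le> 2 * B * (\<Sum>j=1..N. gap w j)" using B0 by (intro mult_left_mono) auto
        then show ?thesis using B[OF w(1)] B[OF w(2)] by linarith
      qed
    qed
    also have "\<dots> = 2 * B * (\<Sum>j=1..N. err ?\<rho> j)"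
      unfolding err_def expectation_sum_finite[OF fr, symmetric] by simp
    also have "\<dots> \<le> 2 * B * (\<Sum>j=1..N. theta ^ k)"
    proof (intro mult_left_mono sum_mono)
      have g: "gap (x, y) j \<le> 1" if "j \<in> {1..N}" for j
      proof -
        have "x j \<in> {-1, 1}" "y j \<in> {-1, 1}"
          using xy that unfolding configs_def by (blast dest: PiE_mem)+
        then show ?thesis by (auto simp: gap_def)
      qed
      show "err ?\<rho> j \<le> theta ^ k" if "j \<in> {1..N}" for j
        unfolding Q_def using err_double_sweep_power[OF th(2) g that] .
    qed (use B0 in simp)
    finally show ?thesis using l by (simp add: abs_mult)
  qed
  have "\<bar>f x - f y\<bar> \<le> 2 * B * real N * (theta / l) ^ k" for k
    using bound[of k] l by (simp add: power_divide le_divide_eq mult.commute)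
  then have ev0: "\<exists>K. \<forall>k\<ge>K. \<bar>f x - f y\<bar> \<le> 2 * B * real N * (theta / l) ^ k" by blast
  have lim: "(\<lambda>k. 2 * B * real N * (theta / l) ^ k) \<longlonglongrightarrow> 2 * B * real N * 0"
    using th l theta_nonneg by (intro tendsto_mult_left LIMSEQ_realpow_zero) auto
  have "\<bar>f x - f y\<bar> \<le> 0"
    using LIMSEQ_le_const[OF lim ev0] by simp
  then show ?thesis by simp
qed

text \<open>By \<open>eigenfunction_constant\<close> every eigenfunction above \<open>theta\<close>
  is constant on configurations. This makes the eigenvalue 1 simple and, as constants belong to 1,
  leaves no other eigenvalue above \<open>theta\<close>.\<close>

lemma spectral_gap_double_sweep_ge:
  assumes th: "theta < 1"
  shows "spectral_gap (configs N) double_sweep \<ge> 1 - theta"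
proof -
  have expc: "measure_pmf.expectation (double_sweep x) f = c"
    if "x \<in> configs N" "\<And>y. y \<in> configs N \<Longrightarrow> f y = c" for f :: "(nat \<Rightarrow> real) \<Rightarrow> real" and x c
  proof -
    have "measure_pmf.expectation (double_sweep x) f = measure_pmf.expectation (double_sweep x) (\<lambda>_. c)"
      using set_scan_configs[OF _ that(1), of there_and_back] set_there_and_back that(2)
      by (intro expectation_cong_pmf) blast
    then show ?thesis by simp
  qed
  obtain x0 where x0: "x0 \<in> configs N" using configs_nonempty by blast
  have "eigenspace (configs N) double_sweep 1 = {\<lambda>x. c * indicator (configs N) x | c. True}"
  proof (intro equalityI subsetI)
    fix f assume f: "f \<in> eigenspace (configs N) double_sweep 1"
    have "f x = f x0 * indicator (configs N) x" for x
    proof (cases "x \<in> configs N")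
      case True
      then show ?thesis using eigenfunction_constant[OF th _ f True x0] th by simp
    qed (use f in \<open>simp add: eigenspace_def\<close>)
    then show "f \<in> {\<lambda>x. c * indicator (configs N) x | c. True}" by blast
  next
    fix f :: "(nat \<Rightarrow> real) \<Rightarrow> real"
    assume "f \<in> {\<lambda>x. c * indicator (configs N) x | c. True}"
    then obtain c where f: "f = (\<lambda>x. c * indicator (configs N) x)" by blast
    have "measure_pmf.expectation (double_sweep x) f = c" if "x \<in> configs N" for x
      by (rule expc[OF that]) (simp add: f)
    then show "f \<in> eigenspace (configs N) double_sweep 1" by (simp add: eigenspace_def f)
  qed
  then have mult: "eigen_mult (configs N) double_sweep 1 = 1"
    unfolding eigen_mult_def by (rule dim_scaled_line[where x = x0, rotated]) (simp add: x0)
  define E where "E = {l. kernel_eigenvalue (configs N) double_sweep l \<and> l \<noteq> 0 \<and> l \<noteq> 1}"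
  have "l \<le> theta" if "l \<in> E" for l
  proof (rule ccontr)
    assume "\<not> l \<le> theta"
    then have lt: "theta < l" by simp
    obtain f z where f: "f \<in> eigenspace (configs N) double_sweep l" and z: "f z \<noteq> 0"
      using \<open>l \<in> E\<close> by (auto simp: E_def kernel_eigenvalue_def)
    have zc: "z \<in> configs N" using z f by (auto simp: eigenspace_def)
    have "measure_pmf.expectation (double_sweep z) f = f z"
      by (rule expc[OF zc]) (rule eigenfunction_constant[OF lt less_imp_le[OF th] f _ zc])
    moreover have "measure_pmf.expectation (double_sweep z) f = l * f z"
      using f zc by (simp add: eigenspace_def)
    ultimately show False using z \<open>l \<in> E\<close> by (simp add: E_def)
  qed
  then have "E \<noteq> {} \<Longrightarrow> Sup E \<le> theta" by (intro cSup_least) auto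
  \<comment> \<open>If there is no further nonzero eigenvalue, the gap is 1 by convention, which is
    covered by \<open>theta \<ge> 0\<close>.\<close>
  then show ?thesis
    unfolding spectral_gap_def mult E_def[symmetric] Let_def using theta_nonneg by auto
qed

lemma spectral_gap_cong:
  assumes "\<And>x. x \<in> S \<Longrightarrow> P x = Q x"
  shows "spectral_gap S P = spectral_gap S Q"
proof -
  have "eigenspace S P = eigenspace S Q"
    using assms by (simp add: eigenspace_def fun_eq_iff)
  then show ?thesis by (simp add: spectral_gap_def eigen_mult_def kernel_eigenvalue_def)
qed

text \<open>The term \<open>k = 1\<close> suffices: for \<open>theta < 1\<close> it is at least
  \<open>1 - theta\<close>, and otherwise the claimed bound is not positive.\<close>

lemma gamma_ps_ss_ge: "gamma_ps_ss N \<beta> h \<ge> (1 - theta) / 4"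
proof -
  define G where "G k = spectral_gap (configs N)
     (\<lambda>x. bind_pmf (kernel_power (time_reversal (curie_weiss N \<beta> h) (systemic_scan N \<beta> h)) k x)
       (kernel_power (systemic_scan N \<beta> h) k)) / real k" for k
  have gps: "gamma_ps_ss N \<beta> h = (SUP k\<in>{1..}. G k)"
    unfolding pseudo_spectral_gap_def set_curie_weiss G_def ..
  have "G k \<le> 2" if "k \<ge> 1" for k
  proof -
    have "G k \<le> 2 / real k"
      unfolding G_def by (intro divide_right_mono spectral_gap_bounds finite_configs) simp
    also have "\<dots> \<le> 2" using that by (simp add: divide_le_eq)
    finally show ?thesis .
  qed
  then have "bdd_above (G ` {1..})" by (intro bdd_aboveI[where M = 2]) auto
  then have le: "G 1 \<le> gamma_ps_ss N \<beta> h" unfolding gps by (intro cSUP_upper) auto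
  have G1: "G 1 = spectral_gap (configs N) double_sweep"
    unfolding G_def using spectral_gap_cong[OF reversal_then_scan_eq] by simp
  show ?thesis
  proof (cases "theta < 1")
    case True
    then show ?thesis using spectral_gap_double_sweep_ge le G1 by auto
  next
    case False
    then show ?thesis using spectral_gap_bounds(1)[OF finite_configs, of N double_sweep] le G1 by auto
  qed
qed

end

section \<open>Random scan and monotone coupling\<close>

lemma sqrt_one_plus_le:
  fixes u :: real
  assumes "-1 \<le> u" "u \<le> 2"
  shows "sqrt (1 + u) \<le> 1 + u / 2 - u\<^sup>2 / 16"
proof (rule real_le_lsqrt)
  \<comment> \<open>The coefficient 1/16 is half the Taylor coefficient. The slack absorbs the cubic
    term up to \<open>u = 2\<close>, the value that arises from \<open>u = 2 / s\<close> at
    \<open>s = 1\<close>.\<close>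
  have "(1 + u / 2 - u\<^sup>2 / 16)\<^sup>2 = 1 + u + u\<^sup>2 * (2 - u) / 16 + (u\<^sup>2)\<^sup>2 / 256"
    by (simp add: power2_eq_square field_simps)
  moreover have "u\<^sup>2 * (2 - u) \<ge> 0" using assms by simp
  ultimately show "1 + u \<le> (1 + u / 2 - u\<^sup>2 / 16)\<^sup>2" by (simp add: add_nonneg_nonneg)
  have "u\<^sup>2 \<le> 4"
    using power_mono[of "\<bar>u\<bar>" 2 2] assms by simp
  then show "0 \<le> 1 + u / 2 - u\<^sup>2 / 16" using assms by linarith
qed

text \<open>From e < 2.72 follows e^2 < 8, and (1 - 1/8) / (1 + 1/8) = 7/9.\<close>

lemma tanh_one_le: "tanh (1 :: real) \<le> 7 / 9"
proof -
  have "exp (2 :: real) = exp 1 * exp 1" by (simp add: exp_add[symmetric])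
  also have "\<dots> \<le> (272 / 100) * (272 / 100)"
    using e_less_272 by (intro mult_mono) auto
  finally have "exp (2 :: real) \<le> 8" by simp
  then have "exp (- 2 :: real) \<ge> 1 / 8" by (simp add: exp_minus divide_simps)
  then show ?thesis by (simp add: tanh_real_altdef divide_simps)
qed

text \<open>The derivative of \<open>tanh\<close> on the unit interval is at least 1 - (7/9)^2 =
  32/81, which exceeds 1/3.\<close>

lemma tanh_ge_third:
  fixes m :: real
  assumes "0 \<le> m" "m \<le> 1"
  shows "m / 3 \<le> tanh m"
proof -
  have "tanh 0 - 0 / 3 \<le> tanh m - m / 3"
  proof (rule DERIV_nonneg_imp_nondecreasing[OF assms(1)], intro exI conjI)
    fix x :: real assume x: "0 \<le> x" "x \<le> m"
    show "((\<lambda>x. tanh x - x / 3) has_real_derivative (1 - tanh x ^ 2 - 1 / 3)) (at x)"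
      by (auto intro!: derivative_eq_intros)
    have "tanh x \<le> tanh 1" using x assms by simp
    then have "tanh x \<le> 7 / 9" using tanh_one_le by linarith
    then have "(tanh x)\<^sup>2 \<le> (7 / 9)\<^sup>2" using x by (intro power_mono) auto
    then show "0 \<le> 1 - tanh x ^ 2 - 1 / 3" by (simp add: power2_eq_square)
  qed
  then show ?thesis by simp
qed

text \<open>The derivative of the difference is tanh^2 x - x^2 / 9, nonnegative by
  \<open>tanh_ge_third\<close>; the 27 comes from integrating x^2 / 9.\<close>

lemma tanh_le_cubic:
  fixes m :: real
  assumes "0 \<le> m" "m \<le> 1"
  shows "tanh m \<le> m - m ^ 3 / 27"
proof -
  have "0 - 0 ^ 3 / 27 - tanh 0 \<le> m - m ^ 3 / 27 - tanh m"
  proof (rule DERIV_nonneg_imp_nondecreasing[OF assms(1)], intro exI conjI)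
    fix x :: real assume x: "0 \<le> x" "x \<le> m"
    show "((\<lambda>x. x - x ^ 3 / 27 - tanh x) has_real_derivative (1 - x ^ 2 / 9 - (1 - tanh x ^ 2))) (at x)"
      by (auto intro!: derivative_eq_intros)
    have "(x / 3)\<^sup>2 \<le> (tanh x)\<^sup>2" using tanh_ge_third[of x] x assms by (intro power_mono) auto
    then show "0 \<le> 1 - x ^ 2 / 9 - (1 - tanh x ^ 2)" by (simp add: power_divide)
  qed
  then show ?thesis by simp
qed

text \<open>Used to drop the shifts by 1/N in the drift, which arise since a spin does not feel
  itself. By the addition formula the shifts change \<open>t\<close> by
  \<open>e * (1 - t\<^sup>2)\<close> over \<open>1 + t * e\<close> upwards and over
  \<open>1 - t * e\<close> downwards. The downward change has the smaller denominator and, as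
  \<open>m \<ge> 0\<close>, the larger weight.\<close>

lemma tanh_shift_mean_le:
  fixes m d :: real
  assumes "0 \<le> m" "m \<le> 1" "0 \<le> d"
  shows "(1 - m) / 2 * tanh (m + d) + (1 + m) / 2 * tanh (m - d) \<le> tanh m"
proof -
  define t e where "t = tanh m" and "e = tanh d"
  have t: "0 \<le> t" "t < 1" and e: "0 \<le> e" "e < 1"
    using assms by (simp_all add: t_def e_def tanh_real_lt_1)
  have te: "0 \<le> t * e" "t * e < 1"
    using t e mult_strict_mono[of t 1 e 1] by auto
  have plus: "tanh (m + d) = (t + e) / (1 + t * e)"
    unfolding t_def e_def by (rule tanh_add) simp_all
  have minus: "tanh (m - d) = (t - e) / (1 - t * e)"
    using tanh_add[of m "- d"] by (simp add: t_def e_def)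
  have p: "(t + e) / (1 + t * e) = t + e * (1 - t\<^sup>2) / (1 + t * e)"
    using te by (simp add: field_simps power2_eq_square)
  have n: "(t - e) / (1 - t * e) = t - e * (1 - t\<^sup>2) / (1 - t * e)"
    using te by (simp add: field_simps power2_eq_square)
  have E: "e * (1 - t\<^sup>2) \<ge> 0" using t e by (simp add: power_le_one)
  have "(1 - m) / 2 * (e * (1 - t\<^sup>2) / (1 + t * e)) \<le> (1 - m) / 2 * (e * (1 - t\<^sup>2))"
    using E te assms by (intro mult_left_mono) (auto simp: divide_le_eq mult_left_le_one_le mult_le_cancel_left1)
  also have "\<dots> \<le> (1 + m) / 2 * (e * (1 - t\<^sup>2))"
    using E assms by (intro mult_right_mono) auto
  also have "\<dots> \<le> (1 + m) / 2 * (e * (1 - t\<^sup>2) / (1 - t * e))"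
    using E te assms by (intro mult_left_mono) (auto simp: le_divide_eq mult_le_cancel_left1 mult_left_le)
  finally have "(1 - m) / 2 * (t + e * (1 - t\<^sup>2) / (1 + t * e)) +
      (1 + m) / 2 * (t - e * (1 - t\<^sup>2) / (1 - t * e)) \<le> (1 - m) / 2 * t + (1 + m) / 2 * t"
    unfolding distrib_left right_diff_distrib by linarith
  also have "\<dots> = t" by (simp add: field_simps)
  finally show ?thesis unfolding plus minus p n t_def[symmetric] .
qed

lemma weighted_mean_mono:
  fixes a b a' b' p p' :: real
  assumes "a \<le> a'" "b \<le> b'" "b' \<le> a'" "p \<le> p'" "0 \<le> p" "p \<le> 1"
  shows "a * p + b * (1 - p) \<le> a' * p' + b' * (1 - p')"
proof -
  have "a * p + b * (1 - p) \<le> a' * p + b' * (1 - p)"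
    using assms by (intro add_mono mult_right_mono) auto
  also have "\<dots> = b' + (a' - b') * p" by (simp add: algebra_simps)
  also have "\<dots> \<le> b' + (a' - b') * p'" using assms by (intro add_left_mono mult_left_mono) auto
  finally show ?thesis by (simp add: algebra_simps)
qed

section \<open>One-step contraction of the random scan\<close>

context glauber
begin

definition random_step :: "(nat \<Rightarrow> real) \<Rightarrow> (nat \<Rightarrow> real) pmf" where
  "random_step x = bind_pmf (pmf_of_set {1..N}) (\<lambda>i. update i x)"

definition random_step_pair ::
  "(nat \<Rightarrow> real) \<times> (nat \<Rightarrow> real) \<Rightarrow> ((nat \<Rightarrow> real) \<times> (nat \<Rightarrow> real)) pmf" where
  "random_step_pair z = bind_pmf (pmf_of_set {1..N}) (\<lambda>i. update_pair i z)"

lemma sites: "{1..N} \<noteq> {}" "finite {1..N}" "set_pmf (pmf_of_set {1..N}) = {1..N}"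
  using N_pos by (auto intro!: set_pmf_of_set)

lemma expectation_bind_site:
  assumes "\<And>i. finite (set_pmf (K i))"
  shows "measure_pmf.expectation (bind_pmf (pmf_of_set {1..N}) K) f =
    (\<Sum>i=1..N. measure_pmf.expectation (K i) f) / real N"
  using sites assms by (subst expectation_bind_finite) (auto simp: integral_pmf_of_set)

lemma random_scan_eq:
  assumes "x \<in> configs N"
  shows "random_scan N \<beta> h x = random_step x" "set_pmf (random_step x) \<subseteq> configs N"
  using assms set_update_configs[OF _ assms] unfolding random_scan_def random_step_def
  by (auto intro!: bind_pmf_cong resample_eq_update simp: sites UN_subset_iff simp del: One_nat_def)

lemma couples_random_step: "couples random_step_pair random_step"
  using couples_update by (simp add: couples_def random_step_pair_def random_step_def map_bind_pmf)

lemma finite_kernel_random_step: "finite_kernel random_step"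
  using finite_kernelD[OF finite_kernel_update]
  by (simp add: finite_kernel_def random_step_def sites del: One_nat_def)

lemma finite_kernel_random_step_pair: "finite_kernel random_step_pair"
  using finite_kernelD[OF finite_kernel_update_pair]
  by (simp add: finite_kernel_def random_step_pair_def sites del: One_nat_def)

lemma wasserstein_random_scan_le:
  "x \<in> configs N \<Longrightarrow> y \<in> configs N \<Longrightarrow>
    wasserstein1 (hamming N) (kernel_power (random_scan N \<beta> h) k x)
      (kernel_power (random_scan N \<beta> h) k y) \<le> (\<Sum>j=1..N. err (kernel_power random_step_pair k (x, y)) j)"
  by (rule wasserstein_hamming_le)
    (use random_scan_eq couples_random_step finite_kernel_random_step_pair in auto)

text \<open>Updating \<open>i\<close> removes \<open>err \<rho> i\<close> from the total
  \<open>D\<close> and adds at most \<open>\<beta> / N * (D - err \<rho> i)\<close>; the average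
  over \<open>i\<close> gives the stated factor.\<close>

lemma err_random_step:
  assumes "finite (set_pmf \<rho>)"
  shows "(\<Sum>j=1..N. err (bind_pmf \<rho> random_step_pair) j) \<le>
    (1 - (1 - theta) * (1 / real N)) * (\<Sum>j=1..N. err \<rho> j)"
proof -
  define D where "D = (\<Sum>j=1..N. err \<rho> j)"
  have fin: "finite (set_pmf (bind_pmf \<rho> (update_pair i)))" for i
    using finite_kernelD[OF finite_kernel_update_pair] assms by simp
  \<comment> \<open>Choosing the site before sampling from \<open>\<rho>\<close> lets
    \<open>err_update\<close> be used for one fixed site at a time.\<close>
  have "bind_pmf \<rho> random_step_pair = bind_pmf (pmf_of_set {1..N}) (\<lambda>i. bind_pmf \<rho> (update_pair i))"
    unfolding random_step_pair_def by (rule bind_commute_pmf)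
  then have "(\<Sum>j=1..N. err (bind_pmf \<rho> random_step_pair) j) =
      (\<Sum>j=1..N. (\<Sum>i=1..N. err (bind_pmf \<rho> (update_pair i)) j) / real N)"
    unfolding err_def by (simp only: expectation_bind_site[OF fin])
  also have "\<dots> = (\<Sum>i=1..N. \<Sum>j=1..N. err (bind_pmf \<rho> (update_pair i)) j) / real N"
    by (subst sum.swap) (simp add: sum_divide_distrib[symmetric])
  also have "\<dots> \<le> (\<Sum>i=1..N. (D - err \<rho> i) + \<beta> / real N * (D - err \<rho> i)) / real N"
  proof (intro divide_right_mono sum_mono)
    fix i assume i: "i \<in> {1..N}"
    have R: "(\<Sum>j\<in>{1..N} - {i}. err \<rho> j) = D - err \<rho> i"
      unfolding D_def using i by (subst sum.remove[OF _ i]) auto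
    have "(\<Sum>j=1..N. err (bind_pmf \<rho> (update_pair i)) j) =
        err (bind_pmf \<rho> (update_pair i)) i + (\<Sum>j\<in>{1..N} - {i}. err (bind_pmf \<rho> (update_pair i)) j)"
      using i by (intro sum.remove) auto
    also have "(\<Sum>j\<in>{1..N} - {i}. err (bind_pmf \<rho> (update_pair i)) j) = (\<Sum>j\<in>{1..N} - {i}. err \<rho> j)"
      by (intro sum.cong refl err_update(1)[OF assms]) auto
    finally show "(\<Sum>j=1..N. err (bind_pmf \<rho> (update_pair i)) j) \<le> (D - err \<rho> i) + \<beta> / real N * (D - err \<rho> i)"
      using err_update(2)[OF assms, of i] unfolding R by linarith
  qed simp
  also have "(\<Sum>i=1..N. (D - err \<rho> i) + \<beta> / real N * (D - err \<rho> i)) =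
      (real N * D - D) + \<beta> / real N * (real N * D - D)"
    unfolding sum.distrib sum_distrib_left[symmetric] sum_subtractf D_def by simp
  also have "((real N * D - D) + \<beta> / real N * (real N * D - D)) / real N =
      (1 - (1 - theta) * (1 / real N)) * D"
    using N_pos by (simp add: theta_def field_simps)
  finally show ?thesis unfolding D_def .
qed

lemma contraction_factor_nonneg: "0 \<le> 1 - (1 - theta) * (1 / real N)"
proof -
  have "(1 - theta) * (1 / real N) \<le> 1 * (1 / real N)"
    using theta_nonneg by (intro mult_right_mono) auto
  also have "\<dots> \<le> 1" using N_pos by simp
  finally show ?thesis by simp
qed

lemma kappa_rs_1_ge: "kappa_rs N \<beta> h 1 \<ge> (1 - theta) * (1 / real N)"
proof -
  have "kappa_rs N \<beta> h 1 \<ge> 1 - (1 - (1 - theta) * (1 / real N))"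
  proof (rule ricci_ge[OF configs_nonempty hamming_pos _ contraction_factor_nonneg])
    fix x y assume xy: "x \<in> configs N" "y \<in> configs N"
    show "wasserstein1 (hamming N) (kernel_power (random_scan N \<beta> h) 1 x)
      (kernel_power (random_scan N \<beta> h) 1 y) \<le> (1 - (1 - theta) * (1 / real N)) * hamming N x y"
      using wasserstein_random_scan_le[OF xy, of 1] err_random_step[of "return_pmf (x, y)"]
        hamming_eq_gap[OF xy] by simp
  qed
  then show ?thesis by simp
qed

lemma err_random_power_le:
  assumes "theta \<le> 1"
  shows "(\<Sum>j=1..N. err (kernel_power random_step_pair k z) j) \<le> (\<Sum>j=1..N. gap z j)"
proof (induction k)
  case (Suc k)
  have "(\<Sum>j=1..N. err (kernel_power random_step_pair (Suc k) z) j) \<le>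
    (1 - (1 - theta) * (1 / real N)) * (\<Sum>j=1..N. err (kernel_power random_step_pair k z) j)"
    by (simp only: kernel_power_Suc) (rule err_random_step[OF finite_kernel_power[OF finite_kernel_random_step_pair]])
  also have "\<dots> \<le> 1 * (\<Sum>j=1..N. err (kernel_power random_step_pair k z) j)"
    using assms by (intro mult_right_mono sum_nonneg) auto
  finally show ?case using Suc by simp
qed simp

section \<open>Monotonicity and extreme starting points\<close>

lemma plus_prob_mono: "x \<le> y \<Longrightarrow> plus_prob i x \<le> plus_prob i y"
  unfolding plus_prob_def using beta_pos
  by (auto simp: le_fun_def intro!: divide_right_mono mult_left_mono sum_mono)

lemma mono_expectation_update:
  fixes f :: "(nat \<Rightarrow> real) \<Rightarrow> real"
  assumes "mono f"
  shows "mono (\<lambda>x. measure_pmf.expectation (update i x) f)"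
proof (rule monoI)
  fix x y :: "nat \<Rightarrow> real" assume xy: "x \<le> y"
  have "x(i := 1) \<le> y(i := 1)" "x(i := -1) \<le> y(i := -1)" "y(i := -1) \<le> y(i := 1)"
    using xy by (auto simp: le_fun_def)
  then show "measure_pmf.expectation (update i x) f \<le> measure_pmf.expectation (update i y) f"
    unfolding expectation_update
    by (intro weighted_mean_mono monoD[OF assms] plus_prob_mono xy) auto
qed

lemma expectation_random_step:
  fixes f :: "(nat \<Rightarrow> real) \<Rightarrow> real"
  shows
  "measure_pmf.expectation (random_step x) f = (\<Sum>i=1..N. measure_pmf.expectation (update i x) f) / real N"
  unfolding random_step_def by (intro expectation_bind_site finite_kernelD[OF finite_kernel_update])

lemma mono_expectation_random_step:
  fixes f :: "(nat \<Rightarrow> real) \<Rightarrow> real"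
  assumes "mono f"
  shows "mono (\<lambda>x. measure_pmf.expectation (random_step x) f)"
  unfolding expectation_random_step
  by (intro monoI divide_right_mono sum_mono) (auto intro: monoD[OF mono_expectation_update[OF assms]])

lemma expectation_random_step_Suc:
  fixes f :: "(nat \<Rightarrow> real) \<Rightarrow> real"
  shows
  "measure_pmf.expectation (kernel_power random_step (Suc k) x) f =
    measure_pmf.expectation (kernel_power random_step k x) (\<lambda>y. measure_pmf.expectation (random_step y) f)"
  unfolding kernel_power_Suc
  by (intro expectation_bind_finite finite_kernel_power finite_kernelD[OF finite_kernel_random_step]
    finite_kernel_random_step)

lemma mono_expectation_random_power:
  fixes f :: "(nat \<Rightarrow> real) \<Rightarrow> real"
  shows "mono f \<Longrightarrow> mono (\<lambda>x. measure_pmf.expectation (kernel_power random_step k x) f)"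
proof (induction k arbitrary: f)
  case (Suc k)
  then show ?case
    unfolding expectation_random_step_Suc by (intro Suc.IH mono_expectation_random_step)
qed simp

text \<open>The larger of the coupled spins is plus with probability \<open>max ?p ?q\<close>, which
  is at most the plus probability at \<open>sup x y\<close>; dually for the smaller one and
  \<open>inf x y\<close>. Working with \<open>sup\<close> and \<open>inf\<close> admits starting
  points that are not ordered.\<close>

lemma update_pair_sandwich:
  fixes f :: "(nat \<Rightarrow> real) \<Rightarrow> real"
  assumes "mono f"
  shows "measure_pmf.expectation (update_pair i z) (\<lambda>w. f (sup (fst w) (snd w)) - f (inf (fst w) (snd w))) \<le>
    measure_pmf.expectation (update i (sup (fst z) (snd z))) f -
    measure_pmf.expectation (update i (inf (fst z) (snd z))) f"
proof (cases z)
  case (Pair x y)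
  have upd: "sup (x(i := a)) (y(i := b)) = (sup x y)(i := max a b)"
    "inf (x(i := a)) (y(i := b)) = (inf x y)(i := min a b)" for a b
    by (auto simp: fun_eq_iff sup_max inf_min)
  let ?p = "plus_prob i x" and ?q = "plus_prob i y"
  let ?P = "plus_prob i (sup x y)" and ?R = "plus_prob i (inf x y)"
  define U V U' V' where "U = f ((sup x y)(i := 1))" and "V = f ((sup x y)(i := -1))"
    and "U' = f ((inf x y)(i := 1))" and "V' = f ((inf x y)(i := -1))"
  have ord: "V \<le> U" "V' \<le> U'"
    unfolding U_def V_def U'_def V'_def by (auto intro!: monoD[OF assms] simp: le_fun_def)
  have "measure_pmf.expectation (update_pair i z) (\<lambda>w. f (sup (fst w) (snd w)) - f (inf (fst w) (snd w))) =
      (U * max ?p ?q + V * (1 - max ?p ?q)) - (U' * min ?p ?q + V' * (1 - min ?p ?q))"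
    unfolding Pair expectation_update_pair fst_conv snd_conv upd U_def V_def U'_def V'_def
    by (simp add: min_def max_def algebra_simps)
  also have "\<dots> \<le> (U * ?P + V * (1 - ?P)) - (U' * ?R + V' * (1 - ?R))"
    using plus_prob_mono[of x "sup x y" i] plus_prob_mono[of y "sup x y" i]
      plus_prob_mono[of "inf x y" x i] plus_prob_mono[of "inf x y" y i]
      plus_prob_bounds[of i x] plus_prob_bounds[of i y] plus_prob_bounds[of i "inf x y"]
    by (intro diff_mono weighted_mean_mono ord) auto
  finally show ?thesis
    unfolding Pair fst_conv snd_conv expectation_update U_def V_def U'_def V'_def .
qed

lemma random_step_pair_sandwich:
  fixes f :: "(nat \<Rightarrow> real) \<Rightarrow> real"
  assumes "mono f"
  shows "measure_pmf.expectation (random_step_pair z) (\<lambda>w. f (sup (fst w) (snd w)) - f (inf (fst w) (snd w))) \<le>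
    measure_pmf.expectation (random_step (sup (fst z) (snd z))) f -
    measure_pmf.expectation (random_step (inf (fst z) (snd z))) f"
proof -
  have fin: "finite (set_pmf (update_pair i z))" for i
    by (rule finite_kernelD[OF finite_kernel_update_pair])
  have "measure_pmf.expectation (random_step_pair z) (\<lambda>w. f (sup (fst w) (snd w)) - f (inf (fst w) (snd w))) =
    (\<Sum>i=1..N. measure_pmf.expectation (update_pair i z)
      (\<lambda>w. f (sup (fst w) (snd w)) - f (inf (fst w) (snd w)))) / real N"
    unfolding random_step_pair_def by (rule expectation_bind_site[OF fin])
  also have "\<dots> \<le> (\<Sum>i=1..N. measure_pmf.expectation (update i (sup (fst z) (snd z))) f -
    measure_pmf.expectation (update i (inf (fst z) (snd z))) f) / real N"
    by (intro divide_right_mono sum_mono update_pair_sandwich assms) simp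
  finally show ?thesis
    by (simp add: expectation_random_step sum_subtractf diff_divide_distrib)
qed

text \<open>The induction varies \<open>f\<close>: the last step replaces it by its one-step
  expectation, which is monotone again.\<close>

lemma random_power_pair_sandwich:
  fixes f :: "(nat \<Rightarrow> real) \<Rightarrow> real"
  shows "mono f \<Longrightarrow> measure_pmf.expectation (kernel_power random_step_pair k z)
      (\<lambda>w. f (sup (fst w) (snd w)) - f (inf (fst w) (snd w))) \<le>
    measure_pmf.expectation (kernel_power random_step k (sup (fst z) (snd z))) f -
    measure_pmf.expectation (kernel_power random_step k (inf (fst z) (snd z))) f"
proof (induction k arbitrary: f)
  case (Suc k)
  let ?R = "\<lambda>x. measure_pmf.expectation (random_step x) f"
  have fin: "finite (set_pmf (kernel_power random_step_pair k z))" "finite (set_pmf (random_step_pair w))" for w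
    by (auto intro: finite_kernel_power finite_kernelD[OF finite_kernel_random_step_pair]
      finite_kernel_random_step_pair)
  have "measure_pmf.expectation (kernel_power random_step_pair (Suc k) z)
      (\<lambda>w. f (sup (fst w) (snd w)) - f (inf (fst w) (snd w))) =
    measure_pmf.expectation (kernel_power random_step_pair k z)
      (\<lambda>v. measure_pmf.expectation (random_step_pair v) (\<lambda>w. f (sup (fst w) (snd w)) - f (inf (fst w) (snd w))))"
    using fin by (simp add: expectation_bind_finite)
  also have "\<dots> \<le> measure_pmf.expectation (kernel_power random_step_pair k z)
      (\<lambda>v. ?R (sup (fst v) (snd v)) - ?R (inf (fst v) (snd v)))"
    by (intro expectation_mono_finite fin random_step_pair_sandwich Suc.prems)
  also have "\<dots> \<le> measure_pmf.expectation (kernel_power random_step k (sup (fst z) (snd z))) ?R -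
    measure_pmf.expectation (kernel_power random_step k (inf (fst z) (snd z))) ?R"
    by (rule Suc.IH[OF mono_expectation_random_step[OF Suc.prems]])
  finally show ?case unfolding expectation_random_step_Suc .
qed simp

definition mag :: "(nat \<Rightarrow> real) \<Rightarrow> real" where
  "mag x = (\<Sum>j=1..N. x j)"

lemma mono_mag: "mono mag"
  unfolding mag_def by (intro monoI sum_mono) (simp add: le_fun_def)

lemma sum_gap_eq_mag: "(\<Sum>j=1..N. gap z j) = (mag (sup (fst z) (snd z)) - mag (inf (fst z) (snd z))) / 2"
proof -
  have "gap z j = (sup (fst z) (snd z) j - inf (fst z) (snd z) j) / 2" for j
    by (auto simp: gap_def sup_max inf_min)
  then show ?thesis
    unfolding mag_def by (simp only: sum_subtractf[symmetric] sum_divide_distrib)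
qed

text \<open>The restriction leaves the values outside the sites \<open>undefined\<close>, as in
  \<open>configs\<close>, so that the order on whole functions puts every configuration between the
  two constant ones.\<close>

definition all_spins :: "real \<Rightarrow> nat \<Rightarrow> real" where
  "all_spins s = (\<lambda>i\<in>{1..N}. s)"

text \<open>The number of disagreements is half the magnetization of the \<open>sup\<close> less
  that of the \<open>inf\<close>. The sandwich bounds its mean by two single chains, and
  monotonicity moves their starts to the extremes.\<close>

lemma err_random_power_le_mag:
  assumes "x \<in> configs N" "y \<in> configs N"
  shows "(\<Sum>j=1..N. err (kernel_power random_step_pair k (x, y)) j) \<le>
    (measure_pmf.expectation (kernel_power random_step k (all_spins 1)) mag -
     measure_pmf.expectation (kernel_power random_step k (all_spins (-1))) mag) / 2"
proof -
  have fin: "finite (set_pmf (kernel_power random_step_pair k (x, y)))"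
    by (rule finite_kernel_power[OF finite_kernel_random_step_pair])
  have "(\<Sum>j=1..N. err (kernel_power random_step_pair k (x, y)) j) =
    measure_pmf.expectation (kernel_power random_step_pair k (x, y))
      (\<lambda>w. mag (sup (fst w) (snd w)) - mag (inf (fst w) (snd w))) / 2"
    unfolding err_def expectation_sum_finite[OF fin, symmetric] sum_gap_eq_mag by simp
  also have "\<dots> \<le> (measure_pmf.expectation (kernel_power random_step k (sup x y)) mag -
     measure_pmf.expectation (kernel_power random_step k (inf x y)) mag) / 2"
    using random_power_pair_sandwich[OF mono_mag, of k "(x, y)"] by simp
  also have "\<dots> \<le> (measure_pmf.expectation (kernel_power random_step k (all_spins 1)) mag -
     measure_pmf.expectation (kernel_power random_step k (all_spins (-1))) mag) / 2"
  proof -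
    have b: "z j \<le> all_spins 1 j \<and> all_spins (-1) j \<le> z j" if "z \<in> configs N" for z j
    proof (cases "j \<in> {1..N}")
      case True
      then have "z j \<in> {-1, 1}" using that unfolding configs_def by (blast dest: PiE_mem)
      then show ?thesis using True by (auto simp: all_spins_def)
    next
      case False
      then show ?thesis using that by (auto simp: all_spins_def configs_def PiE_iff extensional_def)
    qed
    have "sup x y \<le> all_spins 1" "all_spins (-1) \<le> inf x y"
      using b[OF assms(1)] b[OF assms(2)] by (auto simp: le_fun_def sup_max inf_min)
    then show ?thesis
      by (intro divide_right_mono diff_mono monoD[OF mono_expectation_random_power[OF mono_mag]]) auto
  qed
  finally show ?thesis .
qed

end

section \<open>The critical phase\<close>

text \<open>The first \<open>K\<close> terms are bounded by 1 and the rest by a geometric series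
  starting at 1. Summing the bound \<open>A * q ^ k\<close> from the beginning would cost the factor
  \<open>A\<close>.\<close>

lemma suminf_ennreal_geometric_le:
  fixes a :: "nat \<Rightarrow> real"
  assumes q: "0 \<le> q" "q < 1" and A: "0 \<le> A" and a0: "\<And>k. a k \<le> 1" and a: "\<And>k. a k \<le> A * q ^ k"
    and K: "A * q ^ K \<le> 1"
  shows "(\<Sum>k. ennreal (a k)) \<le> ennreal (real K + 1 / (1 - q))"
proof -
  define b where "b k = (if k < K then 1 else q ^ (k - K))" for k
  have b0: "b k \<ge> 0" for k using q by (simp add: b_def)
  have ab: "a k \<le> b k" for k
  proof (cases "k < K")
    case False
    then have "A * q ^ k = A * q ^ K * q ^ (k - K)"
      by (simp add: mult.assoc power_add[symmetric])
    also have "\<dots> \<le> 1 * q ^ (k - K)" using K q by (intro mult_right_mono) auto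
    finally show ?thesis using a[of k] False by (simp add: b_def)
  qed (simp add: b_def a0)
  have geo: "(\<lambda>k. b (k + K)) sums (1 / (1 - q))"
    using geometric_sums[of q] q by (simp add: b_def)
  have "b sums (1 / (1 - q) + (\<Sum>k<K. b k))"
    using geo by (simp add: sums_iff_shift)
  also have "(\<Sum>k<K. b k) = real K" by (simp add: b_def)
  finally have b: "b sums (1 / (1 - q) + real K)" .
  have "(\<Sum>k. ennreal (a k)) \<le> (\<Sum>k. ennreal (b k))"
    by (intro suminf_le ennreal_leI ab) auto
  also have "\<dots> = ennreal (suminf b)"
    using b0 b by (intro suminf_ennreal2) (auto simp: sums_iff)
  also have "suminf b = real K + 1 / (1 - q)" using b by (simp add: sums_iff)
  finally show ?thesis .
qed

section \<open>The magnetization walk\<close>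

locale critical_glauber = glauber N 1 0 for N
begin

text \<open>The probability of a step from \<open>s\<close> to \<open>s + 2\<close>: a minus spin is
  chosen, and it becomes plus while the other spins sum to \<open>s + 1\<close>. Dually for
  \<open>down\<close>.\<close>

definition up :: "real \<Rightarrow> real" where
  "up s = (real N - s) / (2 * real N) * ((1 + tanh ((s + 1) / real N)) / 2)"

definition down :: "real \<Rightarrow> real" where
  "down s = (real N + s) / (2 * real N) * ((1 - tanh ((s - 1) / real N)) / 2)"

definition mag_step :: "(real \<Rightarrow> real) \<Rightarrow> real \<Rightarrow> real" where
  "mag_step g s = up s * g (s + 2) + down s * g (s - 2) + (1 - up s - down s) * g s"

text \<open>The factors \<open>(1 + x i) / 2\<close> and \<open>(1 - x i) / 2\<close> select the
  sign of the old spin. In this form the expression is affine in \<open>x i\<close>, so its sum over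
  the sites depends on \<open>mag x\<close> alone.\<close>

lemma expectation_update_mag:
  assumes "i \<in> {1..N}" "x \<in> configs N"
  shows "measure_pmf.expectation (update i x) (\<lambda>y. g (mag y)) = g (mag x) +
    (1 + x i) / 2 * ((1 - tanh ((mag x - 1) / real N)) / 2 * (g (mag x - 2) - g (mag x))) +
    (1 - x i) / 2 * ((1 + tanh ((mag x + 1) / real N)) / 2 * (g (mag x + 2) - g (mag x)))"
proof -
  have xi: "x i = 1 \<or> x i = -1" using assms unfolding configs_def by (blast dest: PiE_mem)
  have M: "(\<Sum>j\<in>{1..N} - {i}. x j) = mag x - x i"
    unfolding mag_def by (subst sum.remove[OF _ assms(1)]) auto
  have upd: "mag (x(i := s)) = mag x - x i + s" for s
    using sum_fun_upd[OF finite_atLeastAtMost assms(1), of x s] M unfolding mag_def by linarith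
  have p: "plus_prob i x = (1 + tanh ((mag x - x i) / real N)) / 2"
    unfolding plus_prob_def M by simp
  from xi show ?thesis
    unfolding expectation_update upd p by (elim disjE) (simp_all add: field_simps)
qed

lemma expectation_random_step_mag:
  assumes "x \<in> configs N"
  shows "measure_pmf.expectation (random_step x) (\<lambda>y. g (mag y)) = mag_step g (mag x)"
proof -
  define A B where "A = (1 - tanh ((mag x - 1) / real N)) / 2 * (g (mag x - 2) - g (mag x))"
    and "B = (1 + tanh ((mag x + 1) / real N)) / 2 * (g (mag x + 2) - g (mag x))"
  have "(\<Sum>i=1..N. measure_pmf.expectation (update i x) (\<lambda>y. g (mag y))) =
      (\<Sum>i=1..N. g (mag x) + (1 + x i) / 2 * A + (1 - x i) / 2 * B)"
    unfolding A_def B_def by (intro sum.cong refl expectation_update_mag assms)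
  also have "\<dots> = (\<Sum>i=1..N. (g (mag x) + A / 2 + B / 2) + x i * ((A - B) / 2))"
    by (intro sum.cong) (auto simp: field_simps)
  also have "\<dots> = real N * (g (mag x) + A / 2 + B / 2) + mag x * ((A - B) / 2)"
    unfolding sum.distrib sum_distrib_right[symmetric] mag_def by (simp add: distrib_left)
  finally have "measure_pmf.expectation (random_step x) (\<lambda>y. g (mag y)) =
      (real N * (g (mag x) + A / 2 + B / 2) + mag x * ((A - B) / 2)) / real N"
    unfolding expectation_random_step by simp
  also have "\<dots> = g (mag x) + (real N + mag x) / (2 * real N) * A + (real N - mag x) / (2 * real N) * B"
    using N_pos by (simp add: field_simps)
  also have "\<dots> = mag_step g (mag x)"
    unfolding A_def B_def mag_step_def up_def down_def by (simp only: algebra_simps)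
  finally show ?thesis .
qed

lemma expectation_random_power_mag:
  assumes "x \<in> configs N"
  shows "measure_pmf.expectation (kernel_power random_step k x) (\<lambda>y. g (mag y)) = (mag_step ^^ k) g (mag x)"
proof (induction k arbitrary: g)
  case (Suc k)
  have "set_pmf (kernel_power random_step k x) \<subseteq> configs N"
    using kernel_power_cong[where P = random_step and Q = random_step and S = "configs N"]
      random_scan_eq(2) assms by blast
  then have "measure_pmf.expectation (kernel_power random_step (Suc k) x) (\<lambda>y. g (mag y)) =
    measure_pmf.expectation (kernel_power random_step k x) (\<lambda>y. mag_step g (mag y))"
    unfolding expectation_random_step_Suc
    by (intro expectation_cong_pmf expectation_random_step_mag) auto
  then show ?case by (simp add: Suc.IH funpow_swap1)
qed simp

lemma up_minus: "up (- s) = down s" and down_minus: "down (- s) = up s"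
proof -
  have neg: "- s + 1 = - (s - 1)" "- s - 1 = - (s + 1)" by simp_all
  show "up (- s) = down s" "down (- s) = up s"
    unfolding up_def down_def neg divide_minus_left tanh_minus by simp_all
qed

text \<open>Without an external field, the flip of all spins exchanges \<open>up\<close> and
  \<open>down\<close>.\<close>

lemma mag_step_odd:
  assumes "\<And>s. g (- s) = - g s"
  shows "mag_step g (- s) = - mag_step g s"
proof -
  have "g (- s + 2) = - g (s - 2)" "g (- s - 2) = - g (s + 2)"
    using assms[of "s - 2"] assms[of "s + 2"] by simp_all
  then show ?thesis
    unfolding mag_step_def up_minus down_minus assms by (simp add: algebra_simps)
qed

lemma up_down_bounds:
  assumes "\<bar>s\<bar> \<le> real N"
  shows "0 \<le> up s" "up s \<le> (real N - s) / (2 * real N)"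
    "0 \<le> down s" "down s \<le> (real N + s) / (2 * real N)"
proof -
  have t: "0 \<le> (1 + tanh u) / 2" "(1 + tanh u) / 2 \<le> 1" "0 \<le> (1 - tanh u) / 2" "(1 - tanh u) / 2 \<le> 1"
    for u :: real
    using tanh_real_gt_neg1[of u] tanh_real_lt_1[of u] by auto
  have s: "0 \<le> (real N - s) / (2 * real N)" "0 \<le> (real N + s) / (2 * real N)"
    using assms by (auto intro!: divide_nonneg_nonneg)
  show "0 \<le> up s" "0 \<le> down s"
    unfolding up_def down_def using t s by (intro mult_nonneg_nonneg; simp)+
  show "up s \<le> (real N - s) / (2 * real N)" "down s \<le> (real N + s) / (2 * real N)"
    unfolding up_def down_def using t s by (intro mult_left_le; simp)+
qed

lemma up_plus_down_le:
  assumes "\<bar>s\<bar> \<le> real N"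
  shows "up s + down s \<le> 1"
proof -
  have "(real N - s) / (2 * real N) + (real N + s) / (2 * real N) = 1"
    using N_pos by (simp add: field_simps)
  then show ?thesis using up_down_bounds[OF assms] by linarith
qed

text \<open>In terms of \<open>m\<close> the drift is half of a weighted mean of shifted
  \<open>tanh\<close> values minus \<open>m\<close>. Removing the shifts leaves (tanh m - m) / 2, of
  cubic order at the critical temperature.\<close>

lemma drift_le:
  assumes "1 \<le> s" "s \<le> real N"
  shows "up s - down s \<le> - ((s / real N) ^ 3) / 54"
proof -
  define m d where "m = s / real N" and "d = 1 / real N"
  have m: "0 \<le> m" "m \<le> 1" "0 \<le> d" using assms N_pos by (auto simp: m_def d_def)
  have coord: "(real N - s) / (2 * real N) = (1 - m) / 2" "(real N + s) / (2 * real N) = (1 + m) / 2"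
    "(s + 1) / real N = m + d" "(s - 1) / real N = m - d"
    using N_pos by (simp_all add: m_def d_def field_simps)
  have "up s - down s = (1 - m) / 2 * ((1 + tanh (m + d)) / 2) - (1 + m) / 2 * ((1 - tanh (m - d)) / 2)"
    unfolding up_def down_def coord ..
  also have "\<dots> = ((1 - m) / 2 * tanh (m + d) + (1 + m) / 2 * tanh (m - d) - m) / 2"
    by (simp add: field_simps)
  also have "\<dots> \<le> (tanh m - m) / 2" using tanh_shift_mean_le[OF m] by simp
  also have "\<dots> \<le> - (m ^ 3) / 54" using tanh_le_cubic[OF m(1,2)] by simp
  finally show ?thesis by (simp add: m_def)
qed

text \<open>A choice probability of at least 1/2 times a flip probability of at least (1 - 7/9) / 2
  = 1/9.\<close>

lemma down_ge:
  assumes "1 \<le> s" "s \<le> real N"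
  shows "1 / 18 \<le> down s"
proof -
  have "(s - 1) / real N \<le> 1" using assms N_pos by simp
  then have "tanh ((s - 1) / real N) \<le> tanh 1" by simp
  then have "2 / 9 \<le> 1 - tanh ((s - 1) / real N)" using tanh_one_le by linarith
  moreover have "1 / 2 \<le> (real N + s) / (2 * real N)" using assms N_pos by (simp add: field_simps)
  ultimately have "1 / 2 * (1 / 9) \<le> (real N + s) / (2 * real N) * ((1 - tanh ((s - 1) / real N)) / 2)"
    using assms by (intro mult_mono) auto
  then show ?thesis by (simp add: down_def)
qed

section \<open>Decay of the expected magnetization\<close>

definition rate :: real where
  "rate = 1 / (40 * real N powr (3/2))"

lemma powr_ge_1: "real N powr (3/2) \<ge> 1"
  using N_pos by (simp add: ge_one_powr_ge_zero)

lemma rate_bounds: "0 < rate" "rate < 1"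
  using powr_ge_1 N_pos unfolding rate_def by (auto simp: divide_less_eq)

text \<open>The first-order terms \<open>1 / s\<close> and \<open>- 1 / s\<close> combine to the
  drift, while concavity of \<open>sqrt\<close> loses \<open>1 / (4 * s\<^sup>2)\<close> in both
  directions. The two losses balance where \<open>s\<^sup>2\<close> is of the order of
  \<open>R\<close>, with \<open>R\<^sup>2 = N ^ 3\<close>.\<close>

lemma mag_step_sqrt_le:
  assumes n: "1 \<le> n" "n \<le> N"
  shows "mag_step sqrt (real n) \<le> (1 - rate) * sqrt (real n)"
proof -
  define s where "s = real n"
  have s: "1 \<le> s" "s \<le> real N" "\<bar>s\<bar> \<le> real N" using n by (auto simp: s_def)
  have sqrt_mult: "sqrt (s + u) = sqrt s * sqrt (1 + u / s)" for u
    using s by (simp add: real_sqrt_mult[symmetric] distrib_left)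
  have plus: "sqrt (s + 2) \<le> sqrt s * (1 + 1 / s - 1 / (4 * s\<^sup>2))"
  proof -
    have "2 / s \<le> 2" "-1 \<le> 2 / s" using s by (auto simp: divide_le_eq le_divide_eq)
    then have "sqrt (1 + 2 / s) \<le> 1 + 1 / s - 1 / (4 * s\<^sup>2)"
      using sqrt_one_plus_le[of "2 / s"] by (simp add: power_divide)
    then show ?thesis unfolding sqrt_mult using s by (intro mult_left_mono) auto
  qed
  have minus: "sqrt (s - 2) \<le> sqrt s * (1 - 1 / s - 1 / (4 * s\<^sup>2))"
  proof (cases "n = 1")
    case True
    \<comment> \<open>\<open>sqrt\<close> is an odd function here, so the left side at
      \<open>s = 1\<close> is -1, below the right side -1/4. The same convention matches the odd
      functions in \<open>mag_step_compare\<close>.\<close>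
    have "sqrt (- 1) = - 1" using real_sqrt_minus[of 1] by simp
    then show ?thesis using True by (simp add: s_def)
  next
    case False
    then have "s \<ge> 2" using n by (simp add: s_def)
    then have "0 \<le> 2 / s" "2 / s \<le> 1" by auto
    then have "- 2 / s \<le> 2" "-1 \<le> - 2 / s" unfolding divide_minus_left by linarith+
    then have le: "sqrt (1 + - 2 / s) \<le> 1 - 1 / s - 1 / (4 * s\<^sup>2)"
      using sqrt_one_plus_le[of "- 2 / s"] by (simp add: power_divide)
    have "sqrt (s - 2) = sqrt s * sqrt (1 + - 2 / s)" using sqrt_mult[of "- 2"] by simp
    also have "\<dots> \<le> sqrt s * (1 - 1 / s - 1 / (4 * s\<^sup>2))"
      using le s by (intro mult_left_mono) auto
    finally show ?thesis .
  qed
  note ud = up_down_bounds[OF s(3)] up_plus_down_le[OF s(3)]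
  define R where "R = real N powr (3/2)"
  have R: "R \<ge> 1" using powr_ge_1 by (simp add: R_def)
  have R2: "real N ^ 3 = R\<^sup>2"
  proof -
    have "R\<^sup>2 = real N powr (3/2 + 3/2)"
      unfolding R_def power2_eq_square by (rule powr_add[symmetric])
    also have "3/2 + 3/2 = real 3" by simp
    also have "real N powr real 3 = real N ^ 3" using N_pos by (intro powr_realpow) simp
    finally show ?thesis ..
  qed
  have "mag_step sqrt s \<le> up s * (sqrt s * (1 + 1 / s - 1 / (4 * s\<^sup>2))) +
      down s * (sqrt s * (1 - 1 / s - 1 / (4 * s\<^sup>2))) + (1 - up s - down s) * sqrt s"
    unfolding mag_step_def using plus minus ud by (intro add_mono mult_left_mono) auto
  also have "\<dots> = sqrt s * (1 + (up s - down s) * (1 / s) - (up s + down s) * (1 / (4 * s\<^sup>2)))"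
    by (simp only: algebra_simps)
  also have "\<dots> \<le> sqrt s * (1 - rate)"
  proof (rule mult_left_mono)
    have "(up s - down s) * (1 / s) \<le> (- ((s / real N) ^ 3) / 54) * (1 / s)"
      using drift_le[OF s(1,2)] s by (intro mult_right_mono) auto
    also have "\<dots> = - (s\<^sup>2 / (54 * R\<^sup>2))"
    proof -
      have "s ^ 3 * (1 / s) = s\<^sup>2" using s by (simp add: power3_eq_cube power2_eq_square)
      moreover have "- (s ^ 3 / R\<^sup>2) / 54 * (1 / s) = - (s ^ 3 * (1 / s) / (54 * R\<^sup>2))"
        by (simp add: mult_ac)
      ultimately show ?thesis unfolding power_divide R2 by simp
    qed
    finally have 1: "(up s - down s) * (1 / s) \<le> - (s\<^sup>2 / (54 * R\<^sup>2))" .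
    have "1 / 18 * (1 / (4 * s\<^sup>2)) \<le> (up s + down s) * (1 / (4 * s\<^sup>2))"
      using down_ge[OF s(1,2)] ud by (intro mult_right_mono) auto
    then have 2: "1 / (72 * s\<^sup>2) \<le> (up s + down s) * (1 / (4 * s\<^sup>2))" by simp
    have "1 / (40 * R) \<le> s\<^sup>2 / (54 * R\<^sup>2) + 1 / (72 * s\<^sup>2)"
    proof -
      define w where "w = s\<^sup>2 / R"
      have w: "w > 0" using s R by (simp add: w_def)
      \<comment> \<open>In \<open>w\<close> both losses are multiples of \<open>1 / R\<close>. The
        square is centred at the vertex of 2880 w^2 - 3888 w + 2160, whose minimum is still
        positive: the optimal constant is about 1/31.2, and 1/40 lies below it.\<close>
      have "0 \<le> 2880 * (w - 27 / 40)\<^sup>2" by simp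
      then have "54 * 72 * w \<le> 40 * (72 * w\<^sup>2 + 54)" by (simp add: power2_eq_square algebra_simps)
      then have "1 / 40 \<le> w / 54 + 1 / (72 * w)"
        using w by (simp add: field_simps power2_eq_square)
      then have "1 / 40 * (1 / R) \<le> (w / 54 + 1 / (72 * w)) * (1 / R)"
        using R by (intro mult_right_mono) auto
      also have "\<dots> = s\<^sup>2 / (54 * R\<^sup>2) + 1 / (72 * s\<^sup>2)"
      proof -
        have "w / 54 * (1 / R) = s\<^sup>2 / (54 * R\<^sup>2)"
          unfolding w_def power2_eq_square[of R] by (simp add: mult_ac)
        moreover have "1 / (72 * w) * (1 / R) = 1 / (72 * s\<^sup>2)"
          unfolding w_def using R by simp
        ultimately show ?thesis unfolding distrib_right by simp
      qed
      finally show ?thesis by simp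
    qed
    then show "1 + (up s - down s) * (1 / s) - (up s + down s) * (1 / (4 * s\<^sup>2)) \<le> 1 - rate"
      using 1 2 unfolding rate_def R_def by linarith
  qed (use s in simp)
  finally show ?thesis by (simp add: s_def mult.commute)
qed

text \<open>For odd \<open>g\<close> the value \<open>g (-1)\<close> reached from \<open>s = 1\<close> equals \<open>- g 1\<close>: the walk reflected at
  the origin still has a nonnegative weight at \<open>1\<close>, so comparison on the positive half line suffices.\<close>

lemma mag_step_compare:
  assumes odd: "\<And>s. g (- s) = - g s" and c: "c \<ge> 0"
    and le: "\<And>n. 1 \<le> n \<Longrightarrow> n \<le> N \<Longrightarrow> even (N - n) \<Longrightarrow> g (real n) \<le> c * sqrt (real n)"
    and n: "1 \<le> n" "n \<le> N" "even (N - n)"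
  shows "mag_step g (real n) \<le> c * mag_step sqrt (real n)"
proof -
  define s where "s = real n"
  have s: "\<bar>s\<bar> \<le> real N" using n by (simp add: s_def)
  note ud = up_down_bounds[OF s] up_plus_down_le[OF s]
  have g0: "g 0 = 0" using odd[of 0] by simp
  have up_le: "up s * g (s + 2) \<le> up s * (c * sqrt (s + 2))"
  proof (cases "n = N")
    \<comment> \<open>At the top no bound beyond \<open>N\<close> is called for, since
      \<open>up\<close> vanishes there.\<close>
    case True
    then show ?thesis by (simp add: s_def up_def)
  next
    case False
    \<comment> \<open>Parity excludes \<open>n = N - 1\<close>, from which an upward step would
      leave the range covered by \<open>le\<close>.\<close>
    then have "n + 2 \<le> N" "even (N - (n + 2))" using n by (auto elim!: evenE) presburger+
    then have "g (real (n + 2)) \<le> c * sqrt (real (n + 2))" using n by (intro le) auto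
    then show ?thesis using ud by (intro mult_left_mono) (auto simp: s_def add.commute)
  qed
  have here: "g s \<le> c * sqrt s" using le n by (simp add: s_def)
  show ?thesis
  proof (cases "n = 1")
    case True
    then have s1: "s = 1" by (simp add: s_def)
    \<comment> \<open>Since tanh 0 = 0, \<open>down 1\<close> is exactly (N + 1) / (4 N), so
      \<open>up 1 + 2 * down 1\<close> is at most 1.\<close>
    have "(real N - 1) / (2 * real N) + 2 * ((real N + 1) / (2 * real N) * (1 / 2)) = 1"
      using N_pos by (simp add: field_simps)
    moreover have "down 1 = (real N + 1) / (2 * real N) * (1 / 2)" by (simp add: down_def)
    ultimately have stay: "0 \<le> 1 - up 1 - 2 * down 1" using ud(2) s1 by simp
    have neg: "g (1 - 2) = - g 1" "sqrt (1 - 2) = - sqrt 1"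
      using odd[of 1] real_sqrt_minus[of 1] by simp_all
    have "mag_step g 1 = up 1 * g (1 + 2) + (1 - up 1 - 2 * down 1) * g 1"
      unfolding mag_step_def neg by (simp add: algebra_simps)
    also have "\<dots> \<le> up 1 * (c * sqrt (1 + 2)) + (1 - up 1 - 2 * down 1) * (c * sqrt 1)"
      using here stay by (intro add_mono[OF up_le[unfolded s1]] mult_left_mono) (simp_all add: s1)
    also have "\<dots> = c * mag_step sqrt 1"
      unfolding mag_step_def neg by (simp add: algebra_simps)
    finally show ?thesis using True by simp
  next
    case False
    have "g (s - 2) \<le> c * sqrt (s - 2)"
    proof (cases "n = 2")
      case True
      then show ?thesis by (simp add: s_def g0)
    next
      case False
      then have n2: "1 \<le> n - 2" "n - 2 \<le> N" "even (N - (n - 2))" and "s - 2 = real (n - 2)"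
        using n \<open>n \<noteq> 1\<close> by (auto simp: s_def)
      then show ?thesis using le[OF n2] by simp
    qed
    then have "mag_step g s \<le> up s * (c * sqrt (s + 2)) + down s * (c * sqrt (s - 2)) +
        (1 - up s - down s) * (c * sqrt s)"
      unfolding mag_step_def using here ud
      by (intro add_mono[OF add_mono[OF up_le]] mult_left_mono) auto
    also have "\<dots> = c * mag_step sqrt s" unfolding mag_step_def by (simp add: algebra_simps)
    finally show ?thesis by (simp add: s_def)
  qed
qed

text \<open>The induction starts from n <= sqrt N * sqrt n for n <= N. Oddness is carried along
  because \<open>mag_step_compare\<close> relies on it near the origin.\<close>

lemma mag_step_power:
  "(\<forall>s. (mag_step ^^ k) id (- s) = - (mag_step ^^ k) id s) \<and>
   (\<forall>n. 1 \<le> n \<longrightarrow> n \<le> N \<longrightarrow> even (N - n) \<longrightarrow>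
     (mag_step ^^ k) id (real n) \<le> (1 - rate) ^ k * sqrt (real N) * sqrt (real n))"
proof (induction k)
  case 0
  have "real n \<le> sqrt (real N) * sqrt (real n)" if "n \<le> N" for n
    using that by (subst real_sqrt_mult[symmetric], intro real_le_rsqrt)
      (simp add: power2_eq_square mult_right_mono)
  then show ?case by simp
next
  case (Suc k)
  let ?g = "(mag_step ^^ k) id" and ?c = "(1 - rate) ^ k * sqrt (real N)"
  have c: "?c \<ge> 0" using rate_bounds by simp
  have odd: "?g (- s) = - ?g s" for s using Suc by blast
  have "mag_step ?g (real n) \<le> (1 - rate) ^ Suc k * sqrt (real N) * sqrt (real n)"
    if n: "1 \<le> n" "n \<le> N" "even (N - n)" for n
  proof -
    have "mag_step ?g (real n) \<le> ?c * mag_step sqrt (real n)"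
    proof (rule mag_step_compare[where g = ?g and c = ?c])
      show "?g (- s) = - ?g s" for s by (rule odd)
      show "?g (real n) \<le> ?c * sqrt (real n)" if "1 \<le> n" "n \<le> N" "even (N - n)" for n
        using Suc that by blast
    qed (use c n in auto)
    also have "\<dots> \<le> ?c * ((1 - rate) * sqrt (real n))"
      by (intro mult_left_mono mag_step_sqrt_le n c)
    finally show ?thesis by (simp add: mult_ac)
  qed
  moreover have "mag_step ?g (- s) = - mag_step ?g s" for s
    by (rule mag_step_odd) (rule odd)
  ultimately show ?case by (simp only: funpow.simps comp_apply) blast
qed

lemma all_spins_configs: "s \<in> {-1, 1} \<Longrightarrow> all_spins s \<in> configs N"
  by (auto simp: all_spins_def configs_def)

lemma mag_all_spins: "mag (all_spins s) = real N * s"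
  by (simp add: mag_def all_spins_def)

text \<open>By oddness the two extreme starts contribute opposite values, so half their difference
  is the value at \<open>N\<close>, where sqrt N * sqrt N = N.\<close>

lemma err_random_power_decay:
  assumes "x \<in> configs N" "y \<in> configs N"
  shows "(\<Sum>j=1..N. err (kernel_power random_step_pair k (x, y)) j) \<le> real N * (1 - rate) ^ k"
proof -
  have E: "measure_pmf.expectation (kernel_power random_step k (all_spins s)) mag =
      (mag_step ^^ k) id (real N * s)" if "s \<in> {-1, 1}" for s
    using expectation_random_power_mag[OF all_spins_configs[OF that], where g = id and k = k]
    by (simp add: mag_all_spins)
  have "(mag_step ^^ k) id (real N) \<le> (1 - rate) ^ k * sqrt (real N) * sqrt (real N)"
    using mag_step_power N_pos by simp
  also have "\<dots> = real N * (1 - rate) ^ k" by (simp add: mult.assoc)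
  finally have "(mag_step ^^ k) id (real N) \<le> real N * (1 - rate) ^ k" .
  moreover have "(mag_step ^^ k) id (- real N) = - (mag_step ^^ k) id (real N)"
    using mag_step_power by blast
  ultimately show ?thesis
    using err_random_power_le_mag[OF assms, of k] E[of 1] E[of "-1"] by simp
qed

section \<open>Curvature of the critical random scan\<close>

lemma theta_le_1: "theta \<le> 1"
  using N_pos by (simp add: theta_def)

text \<open>Since \<open>theta \<le> 1\<close>, the expected distance never increases. This bounds
  the early terms of the curvature sum by 1.\<close>

lemma kappa_rs_nonneg: "kappa_rs N 1 0 k \<ge> 0"
proof -
  have "kappa_rs N 1 0 k \<ge> 1 - 1"
  proof (rule ricci_ge[OF configs_nonempty hamming_pos])
    fix x y assume xy: "x \<in> configs N" "y \<in> configs N"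
    show "wasserstein1 (hamming N) (kernel_power (random_scan N 1 0) k x)
      (kernel_power (random_scan N 1 0) k y) \<le> 1 * hamming N x y"
      using wasserstein_random_scan_le[OF xy, of k] err_random_power_le[OF theta_le_1, of k "(x, y)"]
        hamming_eq_gap[OF xy] by simp
  qed auto
  then show ?thesis by simp
qed

lemma kappa_rs_decay: "kappa_rs N 1 0 k \<ge> 1 - real N * (1 - rate) ^ k"
proof (rule ricci_ge[OF configs_nonempty hamming_pos])
  fix x y assume xy: "x \<in> configs N" "y \<in> configs N" "x \<noteq> y"
  have nn: "0 \<le> real N * (1 - rate) ^ k" using rate_bounds by simp
  have "wasserstein1 (hamming N) (kernel_power (random_scan N 1 0) k x)
      (kernel_power (random_scan N 1 0) k y) \<le> real N * (1 - rate) ^ k"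
    using wasserstein_random_scan_le[OF xy(1,2), of k] err_random_power_decay[OF xy(1,2), of k] by simp
  \<comment> \<open>The decay bound does not involve the initial distance; that distance is at least
    1 and may be inserted as a factor.\<close>
  also have "\<dots> \<le> real N * (1 - rate) ^ k * hamming N x y"
    using mult_left_mono[OF hamming_ge_1[OF xy] nn] by simp
  finally show "wasserstein1 (hamming N) (kernel_power (random_scan N 1 0) k x)
      (kernel_power (random_scan N 1 0) k y) \<le> real N * (1 - rate) ^ k * hamming N x y" .
qed (use rate_bounds in auto)

lemma decay_le_exp: "(1 - rate) ^ k \<le> exp (- (rate * real k))"
proof -
  have "(1 - rate) ^ k \<le> exp (- rate) ^ k"
    using rate_bounds exp_ge_add_one_self[of "- rate"] by (intro power_mono) auto
  then show ?thesis by (simp add: exp_of_nat_mult[symmetric] mult.commute)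
qed

lemma decay_le:
  assumes k: "real k \<ge> a * (40 * real N powr (3/2) * ln (real N))"
  shows "(1 - rate) ^ k \<le> real N powr (- a)"
proof -
  have "a * ln (real N) = rate * (a * (40 * real N powr (3/2) * ln (real N)))"
    using powr_ge_1 by (simp add: rate_def)
  also have "\<dots> \<le> rate * real k" using k rate_bounds by (intro mult_left_mono) auto
  finally have "exp (- (rate * real k)) \<le> exp (- (a * ln (real N)))" by simp
  also have "\<dots> = real N powr (- a)" using N_pos by (simp add: powr_def)
  finally show ?thesis using decay_le_exp[of k] by linarith
qed

lemma kappa_rs_half:
  assumes N: "N \<ge> 2" and k: "real k \<ge> 100 * real N powr (3/2) * ln (real N)"
  shows "kappa_rs N 1 0 k \<ge> 1/2"
proof -
  \<comment> \<open>As 100 is at least 2 * 40, the decay factor is at most N^(-2); after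
    multiplication by \<open>N\<close> there remains 1/N, which is at most 1/2.\<close>
  have "2 * (40 * real N powr (3/2) * ln (real N)) \<le> 100 * real N powr (3/2) * ln (real N)"
    using N by simp
  then have "(1 - rate) ^ k \<le> real N powr (- 2)" using k by (intro decay_le) linarith
  also have "\<dots> = 1 / (real N)\<^sup>2" using N by (simp add: powr_minus divide_simps)
  finally have "real N * (1 - rate) ^ k \<le> real N * (1 / (real N)\<^sup>2)" by (intro mult_left_mono) auto
  also have "\<dots> = 1 / real N" using N by (simp add: power2_eq_square)
  also have "\<dots> \<le> 1 / 2" using N by (simp add: divide_simps)
  finally show ?thesis using kappa_rs_decay[of k] by linarith
qed

lemma kappa_sum_rs_le:
  assumes N: "N \<ge> 2"
  shows "kappa_sum_rs N 1 0 \<le> ennreal (2 * 100 * real N powr (3/2) * ln (real N))"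
proof -
  define R where "R = real N powr (3/2)"
  have R: "R \<ge> 1" using powr_ge_1 by (simp add: R_def)
  have "1 / 2 \<le> ln (2 :: real)" using ln2_ge_two_thirds by simp
  also have "\<dots> \<le> ln (real N)" using N by simp
  finally have ln: "1 / 2 \<le> ln (real N)" .
  \<comment> \<open>From this index on the bound \<open>real N * (1 - rate) ^ k\<close> is at most
    1.\<close>
  define K where "K = nat \<lceil>40 * R * ln (real N)\<rceil>"
  have K: "40 * R * ln (real N) \<le> real K" "real K \<le> 40 * R * ln (real N) + 1"
    using R ln by (simp_all add: K_def)
  have "(1 - rate) ^ K \<le> real N powr (- 1)"
    by (rule decay_le) (use K in \<open>simp add: R_def\<close>)
  then have NK: "real N * (1 - rate) ^ K \<le> 1"
    using N mult_left_mono[of "(1 - rate) ^ K" "1 / real N" "real N"] by (simp add: powr_minus divide_simps)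
  have "kappa_sum_rs N 1 0 \<le> ennreal (real K + 1 / (1 - (1 - rate)))"
    unfolding ricci_sum_compl_def
  proof (rule suminf_ennreal_geometric_le[OF _ _ _ _ _ NK])
    show "1 - kappa_rs N 1 0 k \<le> 1" for k using kappa_rs_nonneg[of k] by simp
    show "1 - kappa_rs N 1 0 k \<le> real N * (1 - rate) ^ k" for k using kappa_rs_decay[of k] by simp
  qed (use rate_bounds in auto)
  also have "1 / (1 - (1 - rate)) = 40 * R" by (simp add: rate_def R_def)
  also have "ennreal (real K + 40 * R) \<le> ennreal (2 * 100 * R * ln (real N))"
  proof (rule ennreal_leI)
    \<comment> \<open>The remainders 1 and 40 R are at most 2 and 80 times R ln N; with the leading
      40 this makes 122, below 200.\<close>
    have "R * (1 / 2) \<le> R * ln (real N)" using R ln by (intro mult_left_mono) auto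
    moreover have "1 / 2 \<le> R * (1 / 2)" using R by simp
    ultimately show "real K + 40 * R \<le> 2 * 100 * R * ln (real N)" using K(2) by linarith
  qed
  finally show ?thesis unfolding R_def .
qed

end

theorem proposition4p9:
  shows "(\<forall>(N::nat) (\<beta>::real) (h::real). N \<ge> 1 \<longrightarrow> \<beta> > 0 \<longrightarrow>
            kappa_rs N \<beta> h 1 \<ge> (1 - \<beta> * ((real N - 1) / real N)) * (1 / real N) \<and>
            kappa_ss N \<beta> h 1 \<ge> 2 - exp \<beta> \<and>
            (\<forall>k::nat. k \<ge> 2 \<longrightarrow> \<beta> * ((real N - 1) / real N) \<le> 1 \<longrightarrow>
               kappa_ss N \<beta> h k \<ge> 1 - \<beta> * exp \<beta> * (\<beta> * ((real N - 1) / real N)) ^ (k - 1)) \<and>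
            gamma_ps_ss N \<beta> h \<ge> (1 - \<beta> * ((real N - 1) / real N)) / 4)
       \<and> (\<exists>C::real. C > 0 \<and> (\<forall>N::nat. N \<ge> 2 \<longrightarrow>
            (\<forall>k::nat. real k \<ge> C * real N powr (3/2) * ln (real N) \<longrightarrow>
               kappa_rs N 1 0 k \<ge> 1/2) \<and>
            kappa_sum_rs N 1 0 \<le> ennreal (2 * C * real N powr (3/2) * ln (real N))))"
proof (intro conjI)
  show "\<forall>(N::nat) (\<beta>::real) (h::real). N \<ge> 1 \<longrightarrow> \<beta> > 0 \<longrightarrow>
    kappa_rs N \<beta> h 1 \<ge> (1 - \<beta> * ((real N - 1) / real N)) * (1 / real N) \<and>
    kappa_ss N \<beta> h 1 \<ge> 2 - exp \<beta> \<and>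
    (\<forall>k::nat. k \<ge> 2 \<longrightarrow> \<beta> * ((real N - 1) / real N) \<le> 1 \<longrightarrow>
       kappa_ss N \<beta> h k \<ge> 1 - \<beta> * exp \<beta> * (\<beta> * ((real N - 1) / real N)) ^ (k - 1)) \<and>
    gamma_ps_ss N \<beta> h \<ge> (1 - \<beta> * ((real N - 1) / real N)) / 4"
  proof (intro allI impI)
    fix N :: nat and \<beta> h :: real
    assume "N \<ge> 1" "\<beta> > 0"
    then interpret glauber N \<beta> h by unfold_locales
    show "kappa_rs N \<beta> h 1 \<ge> (1 - \<beta> * ((real N - 1) / real N)) * (1 / real N) \<and>
      kappa_ss N \<beta> h 1 \<ge> 2 - exp \<beta> \<and>
      (\<forall>k::nat. k \<ge> 2 \<longrightarrow> \<beta> * ((real N - 1) / real N) \<le> 1 \<longrightarrow>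
         kappa_ss N \<beta> h k \<ge> 1 - \<beta> * exp \<beta> * (\<beta> * ((real N - 1) / real N)) ^ (k - 1)) \<and>
      gamma_ps_ss N \<beta> h \<ge> (1 - \<beta> * ((real N - 1) / real N)) / 4"
      using kappa_rs_1_ge kappa_ss_1_ge kappa_ss_ge gamma_ps_ss_ge unfolding theta_def by blast
  qed
next
  have "(\<forall>k::nat. real k \<ge> 100 * real N powr (3/2) * ln (real N) \<longrightarrow> kappa_rs N 1 0 k \<ge> 1/2) \<and>
    kappa_sum_rs N 1 0 \<le> ennreal (2 * 100 * real N powr (3/2) * ln (real N))" if N: "N \<ge> 2" for N :: nat
  proof -
    interpret critical_glauber N using N by unfold_locales auto
    show ?thesis using kappa_rs_half[OF N] kappa_sum_rs_le[OF N] by blast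
  qed
  then show "\<exists>C::real. C > 0 \<and> (\<forall>N::nat. N \<ge> 2 \<longrightarrow>
    (\<forall>k::nat. real k \<ge> C * real N powr (3/2) * ln (real N) \<longrightarrow> kappa_rs N 1 0 k \<ge> 1/2) \<and>
    kappa_sum_rs N 1 0 \<le> ennreal (2 * C * real N powr (3/2) * ln (real N)))"
    by (intro exI[of _ 100]) auto
qed

end
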